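(* There exists a planar tree linkage with two inequivalent (simple) configurations. More precisely, there exist an integer $n>4$ and real numbers $l_1,l_2$ satisfying the parameter constraints (a)--(f) of the context such that the $n$-petal tree linkage with parameters $n,l_1,l_2$ has a configuration in which all petals are in a restricted configuration, and a configuration in which one or more petal angles are less than $\alpha$, and no motion of the linkage takes one of these two configurations to the other.
   Context: Linkages. A tree linkage is a tree whose edges are labelled with positive numbers. A configuration of it in the plane maps each vertex to a point (joint) and each edge to the closed segment (link) between its end joints, whose length equals the label, such that any two links whose underlying edges share a vertex intersect only at the common joint, and all other pairs of links are disjoint (so every configuration is simple). A motion is a continuous movement of the joints such that the linkage is in a configuration at all times. Two configurations are equivalent if some motion takes one to the other. The $n$-petal tree. It has a central joint $O$ and, for $i=0,\dots,n-1$ (indices mod $n$), a petal consisting of the path $O,A_i,B_i,C_i$ with $\|OA_i\|=1$, $\|A_iB_i\|=l_1$, $\|B_iC_i\|=l_2$. The petal angle $\theta_i\in[0,2\pi)$ is the counterclockwise angle $\angle A_{i-1}OA_i$ from $OA_{i-1}$ to $OA_i$. Petals are indexed in counterclockwise cyclic order about $O$, so $\sum_i\theta_i=2\pi$. Parameters. Let $\bar\theta=2\pi/n$, $\beta=\arcsin l_1$, $\alpha=(2\pi-\beta)/(n-1)$, $l_P(\theta)=\cos\theta-\sqrt{l_1^2-\sin^2\theta}$ for $\theta\in[0,\beta]$, and $\theta_m=\arccos\left(\frac{1-l_1^2+l_2^2}{2l_2}\right)$ (principal values). The constraints, with $n>4$ an integer, are: (a) $l_1<1$; (b) $\bar\theta<\beta$;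 (c) $l_2<l_P(\bar\theta)$; (d) $l_2>\sin\beta\cos\beta$; (e) $l_1+l_2>1$; (f) $\alpha<\theta_m$. Restricted petals. For petal $i$ write $A,B,C$ for $A_i,B_i,C_i$, $A'$ for $A_{i-1}$, and $\theta$ for $\theta_i$. Let $L$ be the line through $O$ and $A'$, and let $\mathcal{C}$ be the circle centred at $A$ with radius $l_1$. If $\theta<\beta$, then $\mathcal{C}$ properly intersects $L$; let $P$ be the intersection point of $\mathcal{C}$ with $L$ nearer to $O$ (it lies in the interior of segment $OA'$), and let $Q$ be the intersection point of $\mathcal{C}$ with segment $OA$. The small arc $PQ$ of $\mathcal{C}$ is the shorter of the two arcs with endpoints $P,Q$; it lies inside triangle $A'OA$. If $B$ is on this arc, let $R\in OA'$ and $S\in OA$ be the feet of the perpendiculars from $B$ to $OA'$ and to $OA$. The petal is in a restricted configuration if (i) $\theta<\beta$; (ii) $B$ is on the open small arc $PQ$ of $\mathcal{C}$; and (iii) $C$ is in the open region bounded by the quadrilateral $ORBS$. *)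

theory Defs
  imports "HOL-Analysis.Analysis"
begin

section \<open>Tree linkages, configurations and motions\<close>

text \<open>The plane is the type \<^typ>\<open>complex\<close>. An edge is a two-element set of vertices.\<close>

definition is_tree :: "'v set \<Rightarrow> 'v set set \<Rightarrow> bool" where
  "is_tree V E \<longleftrightarrow>
     finite V \<and> V \<noteq> {} \<and> (\<forall>e\<in>E. e \<subseteq> V \<and> card e = 2)
     \<and> (\<forall>u\<in>V. \<forall>v\<in>V. (u, v) \<in> {(x, y). {x, y} \<in> E}\<^sup>*)
     \<and> \<not> (\<exists>vs. distinct vs \<and> length vs \<ge> 3
            \<and> (\<forall>i<length vs. {vs ! i, vs ! (Suc i mod length vs)} \<in> E))"

record 'v linkage =
  vertices :: "'v set"
  edges :: "'v set set"
  edge_label :: "'v set \<Rightarrow> real"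

definition tree_linkage :: "'v linkage \<Rightarrow> bool" where
  "tree_linkage T \<longleftrightarrow>
     is_tree (vertices T) (edges T) \<and> (\<forall>e\<in>edges T. edge_label T e > 0)"

definition link :: "('v \<Rightarrow> complex) \<Rightarrow> 'v set \<Rightarrow> complex set" where
  "link p e = convex hull (p ` e)"

lemma link_edge: "link p {u, v} = closed_segment (p u) (p v)"
  by (simp add: link_def segment_convex_hull)

definition configuration :: "'v linkage \<Rightarrow> ('v \<Rightarrow> complex) \<Rightarrow> bool" where
  "configuration T p \<longleftrightarrow>
     (\<forall>u v. {u, v} \<in> edges T \<longrightarrow> dist (p u) (p v) = edge_label T {u, v})
     \<and> (\<forall>e\<in>edges T. \<forall>f\<in>edges T. \<forall>v. e \<inter> f = {v} \<longrightarrow> link p e \<inter> link p f = {p v})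
     \<and> (\<forall>e\<in>edges T. \<forall>f\<in>edges T. e \<inter> f = {} \<longrightarrow> link p e \<inter> link p f = {})"

definition motion :: "'v linkage \<Rightarrow> (real \<Rightarrow> 'v \<Rightarrow> complex) \<Rightarrow> bool" where
  "motion T \<gamma> \<longleftrightarrow>
     (\<forall>v\<in>vertices T. continuous_on {0..1} (\<lambda>t. \<gamma> t v))
     \<and> (\<forall>t\<in>{0..1}. configuration T (\<gamma> t))"

definition equivalent_configurations ::
    "'v linkage \<Rightarrow> ('v \<Rightarrow> complex) \<Rightarrow> ('v \<Rightarrow> complex) \<Rightarrow> bool" where
  "equivalent_configurations T p q \<longleftrightarrow>
     (\<exists>\<gamma>. motion T \<gamma> \<and> (\<forall>v\<in>vertices T. \<gamma> 0 v = p v \<and> \<gamma> 1 v = q v))"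

section \<open>Angles and arcs\<close>

text \<open>Counterclockwise angle in \<open>[0, 2\<pi>)\<close> from the ray \<open>c x\<close> to the ray \<open>c y\<close>.\<close>

definition ccw_angle :: "complex \<Rightarrow> complex \<Rightarrow> complex \<Rightarrow> real" where
  "ccw_angle c x y = Arg2pi ((y - c) / (x - c))"

definition open_ccw_arc :: "complex \<Rightarrow> real \<Rightarrow> complex \<Rightarrow> complex \<Rightarrow> complex set" where
  "open_ccw_arc c r x y =
     {z \<in> sphere c r. 0 < ccw_angle c x z \<and> ccw_angle c x z < ccw_angle c x y}"

text \<open>Arcs of a fixed circle are compared in length by the angle they subtend at the centre.\<close>

definition open_small_arc :: "complex \<Rightarrow> real \<Rightarrow> complex \<Rightarrow> complex \<Rightarrow> complex set" where
  "open_small_arc c r x y =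
     (if ccw_angle c x y < ccw_angle c y x then open_ccw_arc c r x y else open_ccw_arc c r y x)"

section \<open>The petal tree\<close>

datatype petal_vertex = JO | JA nat | JB nat | JC nat

definition petal_tree :: "nat \<Rightarrow> real \<Rightarrow> real \<Rightarrow> petal_vertex linkage" where
  "petal_tree n l1 l2 =
     \<lparr> vertices = {JO} \<union> JA ` {..<n} \<union> JB ` {..<n} \<union> JC ` {..<n},
       edges = (\<Union>i<n. {{JO, JA i}, {JA i, JB i}, {JB i, JC i}}),
       edge_label = (\<lambda>e. if \<exists>i. e = {JO, JA i} then 1
                         else if \<exists>i. e = {JA i, JB i} then l1 else l2) \<rparr>"

text \<open>The index \<open>(i + n - 1) mod n\<close> is \<open>i - 1\<close> modulo \<open>n\<close>.\<close>

definition petal_angle :: "nat \<Rightarrow> (petal_vertex \<Rightarrow> complex) \<Rightarrow> nat \<Rightarrow> real" where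
  "petal_angle n p i = ccw_angle (p JO) (p (JA ((i + n - 1) mod n))) (p (JA i))"

text \<open>
  The abstract tree does not determine the cyclic order of its petals, so the order of the
  indices is imposed here: sweeping counterclockwise from \<open>OA\<^sub>0\<close> meets
  \<open>OA\<^sub>1, \<dots>, OA\<^bsub>n-1\<^esub>\<close> in this order within one turn.
\<close>

definition petal_configuration :: "nat \<Rightarrow> real \<Rightarrow> real \<Rightarrow> (petal_vertex \<Rightarrow> complex) \<Rightarrow> bool" where
  "petal_configuration n l1 l2 p \<longleftrightarrow>
     configuration (petal_tree n l1 l2) p
     \<and> (\<forall>i j. i < j \<and> j < n \<longrightarrow>
          ccw_angle (p JO) (p (JA 0)) (p (JA i)) < ccw_angle (p JO) (p (JA 0)) (p (JA j)))"

lemma sum_petal_angle: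
  assumes p: "petal_configuration n l1 l2 p" and n: "n > 1"
  shows "(\<Sum>i<n. petal_angle n p i) = 2 * pi"
proof -
  define w where "w i = (p (JA i) - p JO) / (p (JA 0) - p JO)" for i
  have d: "dist (p JO) (p (JA i)) = 1" if "i < n" for i
  proof -
    have "{JO, JA i} \<in> edges (petal_tree n l1 l2)"
      using that by (auto simp: petal_tree_def)
    moreover have "edge_label (petal_tree n l1 l2) {JO, JA i} = 1"
      by (auto simp: petal_tree_def)
    ultimately show ?thesis
      using p by (auto simp: petal_configuration_def configuration_def)
  qed
  have ne: "p (JA i) - p JO \<noteq> 0" if "i < n" for i
    using d[OF that] by auto
  have w0: "w i \<noteq> 0" if "i < n" for i
    using ne[OF that] ne[of 0] n by (simp add: w_def)
  have w1: "w 0 = 1"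
    using ne[of 0] n by (simp add: w_def)
  have less: "Arg2pi (w i) < Arg2pi (w j)" if "i < j" "j < n" for i j
    using p that by (auto simp: petal_configuration_def ccw_angle_def w_def)
  obtain m where m: "n = Suc m" "m > 0"
    using n by (cases n) auto
  have step: "petal_angle n p (Suc i) = Arg2pi (w (Suc i)) - Arg2pi (w i)" if "i < m" for i
  proof -
    have "Suc i + n - 1 = i + n" "i < n"
      using that m by auto
    hence "(Suc i + n - 1) mod n = i"
      by (metis mod_add_self2 mod_less)
    moreover have "(p (JA (Suc i)) - p JO) / (p (JA i) - p JO) = w (Suc i) / w i"
      using ne[of 0] m by (simp add: w_def)
    ultimately have "petal_angle n p (Suc i) = Arg2pi (w (Suc i) / w i)"
      by (simp only: petal_angle_def ccw_angle_def)
    also have "\<dots> = Arg2pi (w (Suc i)) - Arg2pi (w i)"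
      using that m less[of i "Suc i"] by (intro Arg2pi_divide w0) auto
    finally show ?thesis .
  qed
  have last: "petal_angle n p 0 = 2 * pi - Arg2pi (w m)"
  proof -
    have "petal_angle n p 0 = Arg2pi (inverse (w m))"
      using m by (simp add: petal_angle_def ccw_angle_def w_def)
    moreover have "Arg2pi (w m) > 0"
      using less[of 0 m] m w1 by (simp add: Arg2pi_of_real[of 1, simplified])
    ultimately show ?thesis
      by (smt (verit) Arg2pi_inverse Arg2pi_eq_0_pi)
  qed
  have "(\<Sum>i<n. petal_angle n p i) = petal_angle n p 0 + (\<Sum>i<m. petal_angle n p (Suc i))"
    unfolding m(1) by (rule sum.lessThan_Suc_shift)
  also have "(\<Sum>i<m. petal_angle n p (Suc i)) = (\<Sum>i<m. Arg2pi (w (Suc i)) - Arg2pi (w i))"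
    by (simp add: step)
  also have "\<dots> = Arg2pi (w m) - Arg2pi (w 0)"
    by (rule sum_lessThan_telescope)
  finally show ?thesis
    using last w1 by (simp add: Arg2pi_of_real[of 1, simplified])
qed

section \<open>Parameters\<close>

definition theta_bar :: "nat \<Rightarrow> real" where
  "theta_bar n = 2 * pi / real n"

definition beta :: "real \<Rightarrow> real" where
  "beta l1 = arcsin l1"

definition alpha :: "nat \<Rightarrow> real \<Rightarrow> real" where
  "alpha n l1 = (2 * pi - beta l1) / (real n - 1)"

definition l_P :: "real \<Rightarrow> real \<Rightarrow> real" where
  "l_P l1 \<theta> = cos \<theta> - sqrt (l1\<^sup>2 - (sin \<theta>)\<^sup>2)"

definition theta_m :: "real \<Rightarrow> real \<Rightarrow> real" where
  "theta_m l1 l2 = arccos ((1 - l1\<^sup>2 + l2\<^sup>2) / (2 * l2))"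

definition petal_parameters :: "nat \<Rightarrow> real \<Rightarrow> real \<Rightarrow> bool" where
  "petal_parameters n l1 l2 \<longleftrightarrow>
     n > 4 \<and> 0 < l1 \<and> 0 < l2
     \<and> l1 < 1
     \<and> theta_bar n < beta l1
     \<and> l2 < l_P l1 (theta_bar n)
     \<and> l2 > sin (beta l1) * cos (beta l1)
     \<and> l1 + l2 > 1
     \<and> alpha n l1 < theta_m l1 l2"

section \<open>Restricted petals\<close>

definition foot_on_segment :: "complex \<Rightarrow> complex \<Rightarrow> complex \<Rightarrow> complex \<Rightarrow> bool" where
  "foot_on_segment x a b r \<longleftrightarrow> r \<in> closed_segment a b \<and> orthogonal (x - r) (b - a)"

text \<open>
  \<open>x\<close> is the intersection point of the circle about \<open>A\<close> of radius \<open>r\<close>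
  with the line \<open>O A'\<close> that is nearer to \<open>O\<close>.
\<close>

definition nearer_intersection ::
    "complex \<Rightarrow> complex \<Rightarrow> complex \<Rightarrow> real \<Rightarrow> complex \<Rightarrow> bool" where
  "nearer_intersection O' A' A r x \<longleftrightarrow>
     x \<in> sphere A r \<inter> affine hull {O', A'}
     \<and> (\<forall>y \<in> sphere A r \<inter> affine hull {O', A'} - {x}. dist O' x < dist O' y)"

text \<open>
  The open region bounded by a closed curve is the library's \<^const>\<open>inside\<close>: the union of
  the bounded components of the complement. In a restricted petal the points \<open>P, Q, R, S\<close>
  are unique.
\<close>

definition restricted_petal ::
    "nat \<Rightarrow> real \<Rightarrow> (petal_vertex \<Rightarrow> complex) \<Rightarrow> nat \<Rightarrow> bool" where
  "restricted_petal n l1 p i \<longleftrightarrow>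
     (let O' = p JO; A' = p (JA ((i + n - 1) mod n)); A = p (JA i); B = p (JB i); C = p (JC i)
      in petal_angle n p i < beta l1
         \<and> (\<exists>P Q R S.
              nearer_intersection O' A' A l1 P
              \<and> Q \<in> sphere A l1 \<inter> closed_segment O' A
              \<and> B \<in> open_small_arc A l1 P Q
              \<and> foot_on_segment B O' A' R
              \<and> foot_on_segment B O' A S
              \<and> C \<in> inside (closed_segment O' R \<union> closed_segment R B
                          \<union> closed_segment B S \<union> closed_segment S O')))"

end

theory Submission
  imports Defs
begin

text \<open>
  A barrier argument. Suppose that during a motion every petal is weakly restricted. Since \<open>C\<close>
  lies in the disc with diameter \<open>OB\<close>, we have \<open>|OB| > l\<^sub>2\<close>, which forces the petal angle above
  \<open>\<theta>\<^sub>m > \<alpha>\<close>; as the angles sum to \<open>2\<pi>\<close>, each is then also less than \<open>\<beta>\<close>. Hence \<open>B\<close> cannot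
  reach \<open>Q\<close>, which is too close to \<open>O\<close>, nor \<open>P\<close>, which lies on the link \<open>OA'\<close>; and \<open>C\<close> cannot
  reach the boundary of \<open>ORBS\<close>: two of its sides are contained in links, and the other two are
  shorter than \<open>l\<^sub>2\<close>. So the weak inequalities are strict, the set of times at which they hold is
  open and closed, and no petal angle ever drops to \<open>\<alpha>\<close>.
\<close>

section \<open>A single petal\<close>

text \<open>\<open>restricted_petal\<close>, with its existential feet and its
  \<open>inside\<close>, is awkward to follow in time, so a motion is tracked by nine real
  inequalities in coordinates divided by \<open>A - O\<close>; for the starting configuration both
  descriptions are verified directly. The petals cannot be treated one at a time: the lower bound on
  an angle comes from its own petal, but the upper bound \<open>beta l1\<close> comes from the lower
  bounds on all other petals, and constraint (f) is what makes these add up. A motion passes through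
  configurations that are not known to be cyclically ordered, so the angle sum is held at 2 pi by
  continuity and integrality. The angle theta_m is the angle AOB at |OB| = l2. By the law of cosines
  AOB grows with |OB| up to the tangent length sqrt(1 - l1^2), and B in the sector A'OA keeps AOB at
  most the petal angle. Constraint (d) makes BR and BS shorter than l2: each is |OB| times the sine
  of an angle below beta, and |OB| is at most the tangent length.\<close>

lemma wedge_polar:
  assumes "w \<noteq> 0" "Im w \<le> 0" "0 \<le> Im (w * cis \<theta>)" "0 < \<theta>" "\<theta> < pi"
  obtains \<phi> where "0 \<le> \<phi>" "\<phi> \<le> \<theta>" "w = of_real (norm w) * cis (- \<phi>)"
proof
  let ?p = "Arg2pi (cnj w)"
  show "0 \<le> ?p" by (rule Arg2pi_ge_0)
  have "cnj w = of_real (norm w) * cis ?p"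
    using Arg2pi_eq[of "cnj w"] by (simp add: cis_conv_exp)
  then show w: "w = of_real (norm w) * cis (- ?p)"
    by (metis cis_cnj complex_cnj_cnj complex_cnj_complex_of_real complex_cnj_mult)
  have "?p \<le> pi" using assms by (simp add: Arg2pi_le_pi)
  have "w * cis \<theta> = of_real (norm w) * cis (\<theta> - ?p)"
    by (subst w) (simp add: cis_mult mult.assoc)
  then have "Im (w * cis \<theta>) = norm w * sin (\<theta> - ?p)" by simp
  then have "0 \<le> sin (\<theta> - ?p)"
    using assms by (simp add: zero_le_mult_iff)
  \<comment> \<open>Otherwise \<open>\<theta> - ?p\<close> would lie strictly between -pi and 0,
    where the sine is negative.\<close>
  then show "?p \<le> \<theta>"
    using sin_gt_zero[of "?p - \<theta>"] sin_minus[of "?p - \<theta>"] \<open>?p \<le> pi\<close> assms(4)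
    by (smt (verit))
qed

text \<open>
  The quadrilateral \<open>ORBS\<close> lies in the disc with diameter \<open>OB\<close>, because it has right
  angles at \<open>R\<close> and \<open>S\<close>.
\<close>

lemma norm_quadrilateral_le:
  assumes "0 < \<theta>" "\<theta> < pi" "Im v \<le> 0" "0 \<le> Im (v * cis \<theta>)"
    and "Re v \<le> Re w" "Re (v * cis \<theta>) \<le> Re (w * cis \<theta>)"
  shows "(norm v)\<^sup>2 + (dist v w)\<^sup>2 \<le> (norm w)\<^sup>2"
proof -
  \<comment> \<open>Oblique coordinates along the two sides of the sector: v = x + y cis(-theta)
    with x, y nonnegative. The hypotheses on real parts then make the angle at v in the triangle 0,
    v, w right or obtuse.\<close>
  define x y where "x = Im (v * cis \<theta>) / sin \<theta>" and "y = - Im v / sin \<theta>"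
  have s: "sin \<theta> > 0" using assms by (simp add: sin_gt_zero)
  have xy: "x \<ge> 0" "y \<ge> 0" using assms s by (auto simp: x_def y_def divide_nonpos_pos)
  have v: "Re v = x + y * cos \<theta>" "Im v = - y * sin \<theta>"
    using s by (auto simp: x_def y_def field_simps)
  have "v \<bullet> (w - v) = x * Re (w - v) + y * Re ((w - v) * cis \<theta>)"
    by (simp add: inner_complex_def v algebra_simps)
  also have "\<dots> \<ge> 0"
    using assms xy by (intro add_nonneg_nonneg mult_nonneg_nonneg) (auto simp: algebra_simps)
  finally have "0 \<le> v \<bullet> (w - v)" .
  moreover have "(norm w)\<^sup>2 = (norm v)\<^sup>2 + (norm (w - v))\<^sup>2 + 2 * (v \<bullet> (w - v))"
    by (simp add: power2_norm_eq_inner algebra_simps inner_commute)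
  ultimately show ?thesis by (simp add: dist_norm norm_minus_commute)
qed

lemma petal_parameters_bounds:
  assumes "petal_parameters n l1 l2"
  shows "0 < beta l1" "beta l1 < pi / 2" "sin (beta l1) = l1" "cos (beta l1) = sqrt (1 - l1\<^sup>2)"
    "0 < theta_m l1 l2" "theta_m l1 l2 < pi"
    "cos (theta_m l1 l2) = (1 - l1\<^sup>2 + l2\<^sup>2) / (2 * l2)"
    "2 * pi - (real n - 1) * theta_m l1 l2 < beta l1"
    "l1 * sqrt (1 - l1\<^sup>2) < l2" "0 < l1" "0 < l2" "l1 < 1" "1 < l1 + l2" "4 < n"
proof -
  note p = assms[unfolded petal_parameters_def]
  show l: "0 < l1" "0 < l2" "l1 < 1" "1 < l1 + l2" "4 < n" using p by auto
  show b: "0 < beta l1" using l arcsin_less_arcsin[of 0 l1] by (simp add: beta_def)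
  show b2: "beta l1 < pi / 2" using l arcsin_lt_bounded[of l1] by (simp add: beta_def)
  show s: "sin (beta l1) = l1" using l by (simp add: beta_def)
  show c: "cos (beta l1) = sqrt (1 - l1\<^sup>2)" using l by (simp add: beta_def cos_arcsin)
  show "l1 * sqrt (1 - l1\<^sup>2) < l2" using p s c by auto
  have "2 * pi - beta l1 < theta_m l1 l2 * (real n - 1)"
    using p l by (simp add: alpha_def pos_divide_less_eq)
  then show "2 * pi - (real n - 1) * theta_m l1 l2 < beta l1" by (simp add: mult.commute)
  have "0 < alpha n l1" using l b2 pi_gt_zero unfolding alpha_def by (intro divide_pos_pos) linarith+
  then show t: "0 < theta_m l1 l2" using p by auto
  have "0 < 1 - l1\<^sup>2" using l by (simp add: power_less_one_iff)
  \<comment> \<open>Equivalent to (1 - l2)^2 <= l1^2. Constraint (e) gives this if l2 <= 1, and (c)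
    excludes l2 > 1.\<close>
  moreover have "1 - l1\<^sup>2 + l2\<^sup>2 \<le> 2 * l2"
  proof (cases "l2 \<le> 1")
    case True
    then have "(1 - l2) * (1 - l2) \<le> l1 * l1" using l by (intro mult_mono) auto
    then show ?thesis by (simp add: power2_eq_square algebra_simps)
  next
    case False
    have "l2 < l_P l1 (theta_bar n)" using p by auto
    also have "\<dots> \<le> 1"
    proof -
      \<comment> \<open>The real \<open>sqrt\<close> is negative on negative arguments, so the
        radicand in \<open>l_P\<close> must be shown nonnegative.\<close>
      have "sin (theta_bar n) \<le> sin (beta l1)"
        using p b2 l by (intro sin_monotone_2pi_le) (auto simp: theta_bar_def intro: order_trans[of _ 0])
      moreover have "theta_bar n \<le> pi" using p b2 pi_gt_zero by linarith
      then have "0 \<le> sin (theta_bar n)"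
        by (intro sin_ge_zero) (auto simp: theta_bar_def)
      ultimately have "(sin (theta_bar n))\<^sup>2 \<le> l1\<^sup>2" by (simp add: s power_mono)
      then have "0 \<le> sqrt (l1\<^sup>2 - (sin (theta_bar n))\<^sup>2)" by simp
      then show ?thesis using cos_le_one[of "theta_bar n"] unfolding l_P_def by linarith
    qed
    finally show ?thesis using False by simp
  qed
  ultimately have y: "0 \<le> (1 - l1\<^sup>2 + l2\<^sup>2) / (2 * l2)" "(1 - l1\<^sup>2 + l2\<^sup>2) / (2 * l2) \<le> 1"
    using l by auto
  then show "cos (theta_m l1 l2) = (1 - l1\<^sup>2 + l2\<^sup>2) / (2 * l2)" by (simp add: theta_m_def)
  show "theta_m l1 l2 < pi"
    using arccos_le_pi2[OF y] pi_gt_zero unfolding theta_m_def by linarith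
qed

text \<open>
  Coordinates of a petal: \<open>w = (B - O) / (A - O)\<close>, \<open>v = (C - O) / (A - O)\<close> and
  \<open>cis \<theta> = (A - O) / (A' - O)\<close>, so that \<open>w * cis \<theta> = (B - O) / (A' - O)\<close>. The nine
  quantities say that the petal angle exceeds \<open>\<theta>\<^sub>m\<close>, that \<open>B\<close> lies in the sector \<open>A'OA\<close> on the
  near side of the points of contact of the tangents from \<open>O\<close> to the circle about \<open>A\<close> and
  further than \<open>l\<^sub>2\<close> from \<open>O\<close>, and that \<open>C\<close> lies in the region \<open>ORBS\<close>.
\<close>

definition petal_slack :: "real \<Rightarrow> real \<Rightarrow> real \<Rightarrow> complex \<Rightarrow> complex \<Rightarrow> real" where
  "petal_slack l1 l2 \<theta> w v =
     Min {\<theta> - theta_m l1 l2, sqrt (1 - l1\<^sup>2) - norm w, norm w - l2,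
          - Im w, Im (w * cis \<theta>), - Im v, Im (v * cis \<theta>),
          Re w - Re v, Re (w * cis \<theta>) - Re (v * cis \<theta>)}"

lemma petal_slack_iff:
  "0 \<le> petal_slack l1 l2 \<theta> w v \<longleftrightarrow>
     theta_m l1 l2 \<le> \<theta> \<and> norm w \<le> sqrt (1 - l1\<^sup>2) \<and> l2 \<le> norm w
     \<and> Im w \<le> 0 \<and> 0 \<le> Im (w * cis \<theta>) \<and> Im v \<le> 0 \<and> 0 \<le> Im (v * cis \<theta>)
     \<and> Re v \<le> Re w \<and> Re (v * cis \<theta>) \<le> Re (w * cis \<theta>)"
  "0 < petal_slack l1 l2 \<theta> w v \<longleftrightarrow>
     theta_m l1 l2 < \<theta> \<and> norm w < sqrt (1 - l1\<^sup>2) \<and> l2 < norm w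
     \<and> Im w < 0 \<and> 0 < Im (w * cis \<theta>) \<and> Im v < 0 \<and> 0 < Im (v * cis \<theta>)
     \<and> Re v < Re w \<and> Re (v * cis \<theta>) < Re (w * cis \<theta>)"
  unfolding petal_slack_def
  by (subst Min_ge_iff Min_gr_iff; simp del: times_complex.sel cis.sel)+

lemma continuous_on_petal_slack [continuous_intros]:
  assumes "continuous_on S f" "continuous_on S g" "continuous_on S h"
  shows "continuous_on S (\<lambda>t. petal_slack l1 l2 (f t) (g t) (h t))"
  unfolding petal_slack_def
  by (simp only: Min_insert Min_singleton finite_insert finite.emptyI insert_not_empty not_False_eq_True)
    (intro continuous_intros assms)

text \<open>With k = 1 - l1^2 the fraction is the cosine of the angle AOB at |OB| = r, and at r = l2
  it is cos theta_m. The right side minus the left is (r - s)(k - r s) / (2 r s), positive up to the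
  tangent length sqrt k.\<close>

lemma chord_angle_less:
  fixes r k s :: real
  assumes "0 < s" "s < r" "r \<le> sqrt k" "0 \<le> k"
  shows "(k + r\<^sup>2) / (2 * r) < (k + s\<^sup>2) / (2 * s)"
proof -
  have "r * s < sqrt k * sqrt k" using assms by (intro mult_le_less_imp_less) auto
  then have "0 < (r - s) * (k - r * s)" using assms by simp
  then have "s * (k + r\<^sup>2) < r * (k + s\<^sup>2)" by (simp add: power2_eq_square algebra_simps)
  then show ?thesis using assms by (simp add: divide_simps mult.commute)
qed

text \<open>Each of the nine walls is excluded in turn. The bound |OB| > l2 (\<open>g3\<close>)
  comes early because \<open>g1\<close> and \<open>g4\<close> use it. The hypotheses
  \<open>avoid\<close> say, in normalized coordinates, that C is off OA, B is off OA', and C is off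
  OA'; that B is off OA follows from lengths.\<close>

lemma petal_slack_pos:
  assumes par: "petal_parameters n l1 l2" and \<theta>: "\<theta> < beta l1"
    and w1: "dist w 1 = l1" and vw: "dist v w = l2"
    and slack: "0 \<le> petal_slack l1 l2 \<theta> w v"
    and avoid: "v \<notin> closed_segment 0 1" "w * cis \<theta> \<notin> closed_segment 0 1"
      "v * cis \<theta> \<notin> closed_segment 0 1"
  shows "0 < petal_slack l1 l2 \<theta> w v"
proof -
  note par = petal_parameters_bounds[OF par]
  define k where "k = 1 - l1\<^sup>2"
  have k: "0 < k" "k < 1" using par by (auto simp: k_def power_less_one_iff)
  have ge: "theta_m l1 l2 \<le> \<theta>" "norm w \<le> sqrt k" "l2 \<le> norm w" "Im w \<le> 0" "0 \<le> Im (w * cis \<theta>)"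
    "Im v \<le> 0" "0 \<le> Im (v * cis \<theta>)" "Re v \<le> Re w" "Re (v * cis \<theta>) \<le> Re (w * cis \<theta>)"
    using slack unfolding petal_slack_iff k_def by blast+
  \<comment> \<open>A point on the ray of a unit link but off the link lies beyond its end, whereas
    B and C have real part below 1 in both frames.\<close>
  have seg: "x \<notin> closed_segment 0 1 \<Longrightarrow> Im x = 0 \<Longrightarrow> 0 \<le> Re x \<Longrightarrow> 1 < Re x" for x :: complex
    by (auto simp: closed_segment_same_Im closed_segment_eq_real_ivl)
  have \<theta>0: "0 < \<theta>" "\<theta> < pi / 2" "\<theta> < pi" using ge(1) par \<theta> by linarith+
  have sc: "0 < sin \<theta>" "0 < cos \<theta>" using \<theta>0 by (auto intro: sin_gt_zero cos_gt_zero)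
  have k1: "sqrt k < 1" using k by simp
  have r: "0 < norm w" "norm w < 1" using ge(2,3) par k1 by linarith+
  then have "w \<noteq> 0" by auto
  obtain \<phi> where \<phi>: "0 \<le> \<phi>" "\<phi> \<le> \<theta>" "w = of_real (norm w) * cis (- \<phi>)"
    using wedge_polar[of w \<theta>] ge(4,5) \<theta>0 \<open>w \<noteq> 0\<close> by blast
  have Rw: "Re w = norm w * cos \<phi>" and Iw: "Im w = - (norm w * sin \<phi>)"
    by (subst \<phi>(3), simp)+
  have wc: "w * cis \<theta> = of_real (norm w) * cis (\<theta> - \<phi>)"
    by (subst \<phi>(3)) (simp add: cis_mult mult.assoc)
  have circle: "2 * Re w = k + (norm w)\<^sup>2"
  proof -
    have "(norm (w - 1))\<^sup>2 = l1\<^sup>2" using w1 by (simp add: dist_norm)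
    moreover have "(norm (w - 1))\<^sup>2 = (Re w - 1)\<^sup>2 + (Im w)\<^sup>2" "(norm w)\<^sup>2 = (Re w)\<^sup>2 + (Im w)\<^sup>2"
      by (simp_all add: cmod_power2)
    ultimately show ?thesis by (simp add: k_def power2_eq_square algebra_simps)
  qed
  have cos\<phi>: "cos \<phi> = (k + (norm w)\<^sup>2) / (2 * norm w)"
    using circle Rw r by (simp add: field_simps)
  have near_v: "Re v < 1" "Re (v * cis \<theta>) < 1"
    using ge(8,9) complex_Re_le_cmod[of w] complex_Re_le_cmod[of "w * cis \<theta>"] r
    by (simp_all add: norm_mult)
  have v0: "v \<noteq> 0" using avoid by auto
  have g3: "l2 < norm w"
  proof -
    \<comment> \<open>C lies in the disc with diameter OB; strictness comes from C differing from
      O.\<close>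
    have "(norm v)\<^sup>2 + l2\<^sup>2 \<le> (norm w)\<^sup>2"
      using norm_quadrilateral_le[of \<theta> v w] ge \<theta>0 vw by simp
    moreover have "0 < (norm v)\<^sup>2" using v0 by simp
    ultimately have "l2\<^sup>2 < (norm w)\<^sup>2" by linarith
    then show ?thesis by (simp add: power2_less_imp_less)
  qed
  have g1: "theta_m l1 l2 < \<theta>"
  proof -
    have "cos \<theta> \<le> cos \<phi>" using \<phi> \<theta>0 by (simp add: cos_monotone_0_pi_le)
    also have "\<dots> < cos (theta_m l1 l2)"
      unfolding cos\<phi> using chord_angle_less[of l2 "norm w" k] g3 ge par k by (simp add: k_def)
    finally show ?thesis
      using cos_monotone_0_pi_le[of \<theta> "theta_m l1 l2"] \<theta>0 par by (smt (verit))
  qed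
  \<comment> \<open>At equality OB is tangent to the circle about A, so AOB would equal beta, but
    AOB is at most the petal angle, which is below beta.\<close>
  have g2: "norm w < sqrt k"
  proof (rule ccontr)
    assume "\<not> ?thesis"
    then have "norm w = sqrt k" using ge by simp
    then have "cos \<phi> = cos (beta l1)"
      using k by (simp add: cos\<phi> par(4) k_def[symmetric] divide_simps flip: power2_eq_square)
    moreover have "cos (beta l1) < cos \<phi>" using \<phi> \<theta> par by (intro cos_monotone_0_pi) auto
    ultimately show False by simp
  qed
  \<comment> \<open>On the line OA and within distance 1 of O, B could only be Q, at distance 1 - l1
    < l2 from O by (e).\<close>
  have g4: "Im w < 0"
  proof (rule ccontr)
    assume "\<not> ?thesis"
    then have i: "Im w = 0" using ge by simp
    then have "norm (w - 1) = \<bar>Re w - 1\<bar>" "norm w = \<bar>Re w\<bar>" by (simp_all add: cmod_def)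
    then have "\<bar>Re w - 1\<bar> = l1" "\<bar>Re w\<bar> < 1" using w1 r by (auto simp: dist_norm)
    then have "Re w = 1 - l1" using par by linarith
    then show False using g3 par \<open>norm w = \<bar>Re w\<bar>\<close> by simp
  qed
  have g5: "0 < Im (w * cis \<theta>)"
  proof (rule ccontr)
    assume "\<not> ?thesis"
    then have i: "Im (w * cis \<theta>) = 0" using ge by simp
    have "0 \<le> Re (w * cis \<theta>)"
      unfolding wc using \<phi> \<theta>0 by (auto intro!: mult_nonneg_nonneg cos_ge_zero)
    then have "1 < Re (w * cis \<theta>)" using seg[OF avoid(2) i] by simp
    then show False using complex_Re_le_cmod[of "w * cis \<theta>"] r by (simp add: norm_mult)
  qed
  have g6: "Im v < 0"
  proof (rule ccontr)
    assume "\<not> ?thesis"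
    then have i: "Im v = 0" using ge by simp
    then have "0 \<le> Re v" using ge(7) sc by (simp add: zero_le_mult_iff)
    then show False using seg[OF avoid(1) i] near_v by simp
  qed
  have g7: "0 < Im (v * cis \<theta>)"
  proof (rule ccontr)
    assume "\<not> ?thesis"
    then have i: "Im (v * cis \<theta>) = 0" using ge by simp
    have "v = (v * cis \<theta>) * cis (- \<theta>)" by (simp add: cis_mult mult.assoc)
    then have "Im v = - Re (v * cis \<theta>) * sin \<theta>" using i by (metis (no_types, lifting) times_complex.sel(2) cis.sel sin_minus mult_zero_left add_0_right mult_minus_left mult_minus_right)
    then have "0 \<le> Re (v * cis \<theta>)" using ge(6) sc by (simp add: zero_le_mult_iff del: times_complex.sel)
    then show False using seg[OF avoid(3) i] near_v by simp
  qed
  text \<open>Neither foot of a perpendicular is as far from \<open>B\<close> as \<open>C\<close> is.\<close>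
  have "norm w * sin \<psi> < l2" if "0 \<le> \<psi>" "\<psi> \<le> \<theta>" for \<psi>
  proof -
    have "norm w * sin \<psi> \<le> sqrt k * l1"
      using ge(2) that \<theta> \<theta>0 par k sin_monotone_2pi_le[of \<psi> "beta l1"]
      by (intro mult_mono) (auto intro: sin_ge_zero)
    then show ?thesis using par(9) by (simp add: k_def mult.commute)
  qed
  then have BS: "- Im w < l2" and BR: "Im (w * cis \<theta>) < l2"
    using \<phi> by (auto simp: Iw wc)
  have g8: "Re v < Re w"
  proof (rule ccontr)
    assume "\<not> ?thesis"
    then have i: "Re v = Re w" using ge by simp
    \<comment> \<open>On the line BS, the wall through B perpendicular to OA' puts C on the S side
      of B, so BC would fit into BS, which is shorter than l2.\<close>
    have "(Im v - Im w) * sin \<theta> \<ge> 0" using ge(9) i by (simp add: algebra_simps)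
    then have "Im w \<le> Im v" using sc by (simp add: zero_le_mult_iff)
    moreover have "\<bar>Im v - Im w\<bar> = l2" using vw i by (simp add: dist_norm cmod_def)
    ultimately show False using BS g6 by linarith
  qed
  have g9: "Re (v * cis \<theta>) < Re (w * cis \<theta>)"
  proof (rule ccontr)
    assume "\<not> ?thesis"
    then have i: "Re ((w - v) * cis \<theta>) = 0" using ge by (simp add: algebra_simps)
    \<comment> \<open>Mirror image of \<open>g8\<close>, in the frame whose real axis is
      OA'.\<close>
    define y where "y = Im ((w - v) * cis \<theta>)"
    have "w - v = ((w - v) * cis \<theta>) * cis (- \<theta>)" by (simp add: cis_mult mult.assoc)
    also have "(w - v) * cis \<theta> = \<i> * y" using i by (simp add: complex_eq_iff y_def del: times_complex.sel)
    finally have wv: "w - v = \<i> * y * cis (- \<theta>)" .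
    then have "Re (w - v) = y * sin \<theta>" by simp
    then have "0 \<le> y * sin \<theta>" using ge(8) by simp
    then have "0 \<le> y" using sc by (simp add: zero_le_mult_iff)
    moreover have "\<bar>y\<bar> = l2" using vw wv by (metis dist_commute dist_norm norm_mult norm_cis norm_ii norm_of_real mult_1 mult.right_neutral)
    moreover have "y = Im (w * cis \<theta>) - Im (v * cis \<theta>)" by (simp add: y_def algebra_simps)
    ultimately show False using BR g7 by linarith
  qed
  show ?thesis
    using g1 g2 g3 g4 g5 g6 g7 g8 g9
    unfolding petal_slack_iff k_def by blast
qed

section \<open>Invariance under motions\<close>

lemma petal_tree_configurationD:
  assumes p: "configuration (petal_tree n l1 l2) p" and i: "i < n" and j: "j < n"
  shows "dist (p JO) (p (JA i)) = 1" "dist (p (JA i)) (p (JB i)) = l1"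
    "dist (p (JB i)) (p (JC i)) = l2"
    "closed_segment (p JO) (p (JA j)) \<inter> closed_segment (p (JB i)) (p (JC i)) = {}"
    "i \<noteq> j \<Longrightarrow> closed_segment (p JO) (p (JA i)) \<inter> closed_segment (p JO) (p (JA j)) = {p JO}"
    "i \<noteq> j \<Longrightarrow> closed_segment (p JO) (p (JA j)) \<inter> closed_segment (p (JA i)) (p (JB i)) = {}"
proof -
  let ?T = "petal_tree n l1 l2"
  have E: "{JO, JA i} \<in> edges ?T" "{JO, JA j} \<in> edges ?T" "{JA i, JB i} \<in> edges ?T"
    "{JB i, JC i} \<in> edges ?T"
    using i j by (auto simp: petal_tree_def)
  have L: "edge_label ?T {JO, JA i} = 1" "edge_label ?T {JA i, JB i} = l1"
    "edge_label ?T {JB i, JC i} = l2"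
    by (auto simp: petal_tree_def doubleton_eq_iff)
  have d: "{u, v} \<in> edges ?T \<Longrightarrow> dist (p u) (p v) = edge_label ?T {u, v}" for u v
    using p by (simp add: configuration_def)
  show "dist (p JO) (p (JA i)) = 1" "dist (p (JA i)) (p (JB i)) = l1"
    "dist (p (JB i)) (p (JC i)) = l2"
    using d E L by auto
  have meet: "\<lbrakk>e \<in> edges ?T; f \<in> edges ?T; e \<inter> f = {v}\<rbrakk> \<Longrightarrow> link p e \<inter> link p f = {p v}" for e f v
    using p by (simp add: configuration_def)
  have disj: "\<lbrakk>e \<in> edges ?T; f \<in> edges ?T; e \<inter> f = {}\<rbrakk> \<Longrightarrow> link p e \<inter> link p f = {}" for e f
    using p by (simp add: configuration_def)
  show "closed_segment (p JO) (p (JA j)) \<inter> closed_segment (p (JB i)) (p (JC i)) = {}"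
    using disj[OF E(2,4)] by (simp add: link_edge)
  show "closed_segment (p JO) (p (JA i)) \<inter> closed_segment (p JO) (p (JA j)) = {p JO}" if "i \<noteq> j"
    using meet[OF E(1,2), of JO] that by (simp add: link_edge)
  show "closed_segment (p JO) (p (JA j)) \<inter> closed_segment (p (JA i)) (p (JB i)) = {}" if "i \<noteq> j"
    using disj[OF E(2,3)] that by (simp add: link_edge)
qed

lemma closed_segment_rescale:
  fixes z o' a :: complex
  assumes "z \<in> closed_segment 0 1"
  shows "o' + z * (a - o') \<in> closed_segment o' a"
  using assms by (auto simp: in_segment scaleR_conv_of_real algebra_simps)

section \<open>Petal angles as arguments of unimodular quotients\<close>

lemma cis_Arg2pi: "z \<noteq> 0 \<Longrightarrow> cis (Arg2pi z) = z / norm z"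
  using Arg2pi_eq[of z] by (simp add: cis_conv_exp field_simps)

text \<open>The rotation taking OA' to OA: continuous in time and telescoping under products, it
  separates off the only discontinuity of the angle, the cut of \<open>Arg2pi\<close>.\<close>

definition petal_turn :: "nat \<Rightarrow> (petal_vertex \<Rightarrow> complex) \<Rightarrow> nat \<Rightarrow> complex" where
  "petal_turn n p i = (p (JA i) - p JO) / (p (JA ((i + n - 1) mod n)) - p JO)"

lemma petal_angle_turn: "petal_angle n p i = Arg2pi (petal_turn n p i)"
  by (simp add: petal_angle_def ccw_angle_def petal_turn_def)

lemma previous_petal:
  assumes "i < n" "1 < n"
  shows "(i + n - 1) mod n < n" "(i + n - 1) mod n \<noteq> i" "Suc ((i + n - 1) mod n) mod n = i"
proof -
  show *: "Suc ((i + n - 1) mod n) mod n = i" using assms by (simp add: mod_Suc_eq)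
  show "(i + n - 1) mod n < n" using assms by simp
  show "(i + n - 1) mod n \<noteq> i"
    using * assms by (metis Suc_lessI n_not_Suc_n mod_less mod_self not_less_eq not_less_zero less_one)
qed

lemma bij_betw_previous_petal:
  fixes n :: nat
  assumes "1 < n"
  shows "bij_betw (\<lambda>i. (i + n - 1) mod n) {..<n} {..<n}"
proof (rule bij_betw_byWitness[where f' = "\<lambda>i. Suc i mod n"])
  have "(Suc i mod n + n - 1) mod n = i" if "i < n" for i
    using that assms by (cases "Suc i = n") auto
  then show "\<forall>i\<in>{..<n}. (Suc i mod n + n - 1) mod n = i" by blast
qed (use assms previous_petal(3)[OF _ assms] in auto)

text \<open>A unimodular nonnegative real is 1, which would make two neighbouring joints A coincide
  although their links meet only at O. Hence the turn never touches the cut of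
  \<open>Arg2pi\<close>.\<close>

lemma petal_turn:
  assumes p: "configuration (petal_tree n l1 l2) p" and i: "i < n" and n: "1 < n"
  shows "norm (petal_turn n p i) = 1" "petal_turn n p i \<notin> \<real>\<^sub>\<ge>\<^sub>0"
    "cis (petal_angle n p i) = petal_turn n p i"
proof -
  let ?j = "(i + n - 1) mod n"
  note j = previous_petal[OF i n]
  have d: "norm (p (JA i) - p JO) = 1" "norm (p (JA ?j) - p JO) = 1"
    using petal_tree_configurationD(1)[OF p i i] petal_tree_configurationD(1)[OF p j(1) i]
    unfolding dist_norm by (metis norm_minus_commute)+
  show n1: "norm (petal_turn n p i) = 1" unfolding petal_turn_def norm_divide d by simp
  show "cis (petal_angle n p i) = petal_turn n p i"
    using cis_Arg2pi[of "petal_turn n p i"] n1 unfolding petal_angle_turn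
    by (metis div_by_1 norm_zero of_real_1 zero_neq_one)
  show "petal_turn n p i \<notin> \<real>\<^sub>\<ge>\<^sub>0"
  proof
    assume "petal_turn n p i \<in> \<real>\<^sub>\<ge>\<^sub>0"
    then have "petal_turn n p i = 1"
      using n1 by (auto simp: nonneg_Reals_def)
    then have "p (JA i) = p (JA ?j)"
      using d(2) by (cases "p (JA ?j) = p JO") (simp_all add: petal_turn_def)
    then have "p (JA i) \<in> {p JO}"
      using petal_tree_configurationD(5)[OF p i j(1)] j(2) ends_in_segment by (metis Int_iff)
    then show False using d by simp
  qed
qed

text \<open>The product of the turns telescopes because passing to the previous index is a
  permutation. This yields a multiple of 2 pi for every configuration, whatever the cyclic order of
  its petals.\<close>

lemma cis_sum_petal_angle:
  assumes p: "configuration (petal_tree n l1 l2) p" and n: "1 < n"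
  shows "cis (\<Sum>i<n. petal_angle n p i) = 1"
proof -
  let ?a = "\<lambda>i. p (JA i) - p JO"
  have a: "?a i \<noteq> 0" if "i < n" for i
    using petal_tree_configurationD(1)[OF p that that] by auto
  have "cis (\<Sum>i<n. petal_angle n p i) = (\<Prod>i<n. cis (petal_angle n p i))"
    by (simp add: cis_conv_exp sum_distrib_left exp_sum)
  also have "\<dots> = (\<Prod>i<n. ?a i) / (\<Prod>i<n. ?a ((i + n - 1) mod n))"
    using petal_turn(3)[OF p _ n] by (simp add: petal_turn_def prod_dividef)
  also have "(\<Prod>i<n. ?a ((i + n - 1) mod n)) = (\<Prod>i<n. ?a i)"
    by (rule prod.reindex_bij_betw[OF bij_betw_previous_petal[OF n]])
  finally show ?thesis using a by simp
qed

definition petal_slack_at ::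
    "nat \<Rightarrow> real \<Rightarrow> real \<Rightarrow> (petal_vertex \<Rightarrow> complex) \<Rightarrow> nat \<Rightarrow> real" where
  "petal_slack_at n l1 l2 p i =
     petal_slack l1 l2 (petal_angle n p i)
       ((p (JB i) - p JO) / (p (JA i) - p JO)) ((p (JC i) - p JO) / (p (JA i) - p JO))"

lemma petal_slack_at_pos:
  assumes par: "petal_parameters n l1 l2" and p: "configuration (petal_tree n l1 l2) p"
    and sum: "(\<Sum>i<n. petal_angle n p i) = 2 * pi"
    and slack: "\<And>i. i < n \<Longrightarrow> 0 \<le> petal_slack_at n l1 l2 p i" and i: "i < n"
  shows "0 < petal_slack_at n l1 l2 p i"
proof -
  have n: "1 < n" using petal_parameters_bounds(14)[OF par] by simp
  let ?j = "(i + n - 1) mod n"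
  note j = previous_petal[OF i n]
  note cfg = petal_tree_configurationD[OF p i]
  define o' a b c a' where "o' = p JO" and "a = p (JA i) - o'" and "b = p (JB i) - o'"
    and "c = p (JC i) - o'" and "a' = p (JA ?j) - o'"
  have a: "norm a = 1" and a': "norm a' = 1"
    using cfg(1)[OF i] petal_tree_configurationD(1)[OF p j(1) i]
    by (simp_all add: dist_norm norm_minus_commute o'_def a_def a'_def)
  then have nz: "a \<noteq> 0" "a' \<noteq> 0" by auto
  have turn: "cis (petal_angle n p i) = a / a'"
    using petal_turn(3)[OF p i n] by (simp add: petal_turn_def o'_def a_def a'_def)
  \<comment> \<open>The other n - 1 angles are each at least theta_m, which leaves at most 2 pi - (n
    - 1) theta_m for this one; (f) makes that less than beta.\<close>
  have bound: "petal_angle n p i < beta l1"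
  proof -
    have "theta_m l1 l2 \<le> petal_angle n p k" if "k < n" for k
      using slack[OF that] by (simp add: petal_slack_at_def petal_slack_iff)
    then have "(\<Sum>k\<in>{..<n} - {i}. theta_m l1 l2) \<le> (\<Sum>k\<in>{..<n} - {i}. petal_angle n p k)"
      by (intro sum_mono) auto
    moreover have "(\<Sum>k\<in>{..<n} - {i}. petal_angle n p k) = 2 * pi - petal_angle n p i"
      using sum i by (simp add: sum_diff1)
    moreover have "(\<Sum>k\<in>{..<n} - {i}. theta_m l1 l2) = (real n - 1) * theta_m l1 l2"
      using i n by (simp add: card_Diff_singleton of_nat_diff)
    ultimately show ?thesis using petal_parameters_bounds(8)[OF par] by linarith
  qed
  have avoid: "x / d \<notin> closed_segment 0 1" if "o' + x \<notin> closed_segment o' (o' + d)" "d \<noteq> 0" for x d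
    using closed_segment_rescale[of "x / d" o' "o' + d"] that by auto
  have bc: "o' + c \<notin> closed_segment o' (o' + a)" "o' + c \<notin> closed_segment o' (o' + a')"
    "o' + b \<notin> closed_segment o' (o' + a')"
    using cfg(4)[OF i] cfg(4)[OF j(1)] cfg(6)[OF j(1)] j(2)
    by (auto simp: o'_def a_def b_def c_def a'_def)
  have "dist (b / a) 1 = norm ((b - a) / a)" "dist (c / a) (b / a) = norm ((c - b) / a)"
    using nz by (simp_all add: dist_norm diff_divide_distrib)
  then have dd: "dist (b / a) 1 = l1" "dist (c / a) (b / a) = l2"
    using cfg(2,3)[OF i] a
    by (simp_all add: norm_divide dist_norm norm_minus_commute a_def b_def c_def)
  have "b / a * cis (petal_angle n p i) = b / a'" "c / a * cis (petal_angle n p i) = c / a'"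
    using nz by (simp_all add: turn)
  then show ?thesis
    using petal_slack_pos[OF par bound dd] slack[OF i] avoid bc nz
    by (simp add: petal_slack_at_def o'_def a_def b_def c_def del: times_complex.sel)
qed

text \<open>By \<open>step\<close> the closed condition (all nonnegative) and the open condition
  (all positive) cut out the same subset of \<open>S\<close>, which is therefore clopen, and it
  contains \<open>t0\<close>.\<close>

lemma connected_barrier:
  fixes g :: "'i \<Rightarrow> 'a::topological_space \<Rightarrow> real"
  assumes S: "connected S" "t0 \<in> S" and J: "finite J"
    and cont: "\<And>j. j \<in> J \<Longrightarrow> continuous_on S (g j)"
    and step: "\<And>t j. \<lbrakk>t \<in> S; \<And>k. k \<in> J \<Longrightarrow> 0 \<le> g k t; j \<in> J\<rbrakk> \<Longrightarrow> 0 < g j t"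
    and start: "\<And>j. j \<in> J \<Longrightarrow> 0 < g j t0" and t: "t \<in> S" "j \<in> J"
  shows "0 < g j t"
proof -
  define T where "T = {t \<in> S. \<forall>j\<in>J. 0 < g j t}"
  \<comment> \<open>\<open>J\<close> is nonempty because it contains \<open>j\<close>, so the
    intersection stays inside \<open>S\<close>.\<close>
  have "openin (top_of_set S) (\<Inter> ((\<lambda>j. S \<inter> g j -` {0<..}) ` J))"
    using J t cont by (intro openin_Inter) (auto intro!: continuous_openin_preimage_gen)
  moreover have "\<Inter> ((\<lambda>j. S \<inter> g j -` {0<..}) ` J) = T"
    using t by (auto simp: T_def)
  moreover have "closedin (top_of_set S) (\<Inter> ((\<lambda>j. S \<inter> g j -` {0..}) ` J))"
    using t cont by (intro closedin_Inter) (auto intro!: continuous_closedin_preimage)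
  moreover have "\<Inter> ((\<lambda>j. S \<inter> g j -` {0..}) ` J) = T"
  proof (intro set_eqI iffI)
    fix x assume "x \<in> \<Inter> ((\<lambda>j. S \<inter> g j -` {0..}) ` J)"
    then have "x \<in> S" "\<And>k. k \<in> J \<Longrightarrow> 0 \<le> g k x" using t(2) by blast+
    from step[OF this] show "x \<in> T" using \<open>x \<in> S\<close> unfolding T_def by blast
  qed (auto simp: T_def less_imp_le)
  ultimately have "T = {} \<or> T = S" using S(1) unfolding connected_clopen by metis
  moreover have "t0 \<in> T" using S start by (simp add: T_def)
  ultimately show ?thesis using t by (auto simp: T_def)
qed

lemma motion_petal_slack_at:
  assumes par: "petal_parameters n l1 l2" and \<gamma>: "motion (petal_tree n l1 l2) \<gamma>"
    and sum: "(\<Sum>i<n. petal_angle n (\<gamma> 0) i) = 2 * pi"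
    and start: "\<And>i. i < n \<Longrightarrow> 0 < petal_slack_at n l1 l2 (\<gamma> 0) i"
    and t: "t \<in> {0..1}" and i: "i < n"
  shows "0 < petal_slack_at n l1 l2 (\<gamma> t) i"
proof -
  have n: "1 < n" using petal_parameters_bounds(14)[OF par] by simp
  have cfg: "configuration (petal_tree n l1 l2) (\<gamma> t)" if "t \<in> {0..1}" for t
    using \<gamma> that by (simp add: motion_def)
  have cont [continuous_intros]: "continuous_on {0..1} (\<lambda>t. \<gamma> t JO)"
    "k < n \<Longrightarrow> continuous_on {0..1} (\<lambda>t. \<gamma> t (JA k))"
    "k < n \<Longrightarrow> continuous_on {0..1} (\<lambda>t. \<gamma> t (JB k))"
    "k < n \<Longrightarrow> continuous_on {0..1} (\<lambda>t. \<gamma> t (JC k))" for k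
    using \<gamma> by (auto simp: motion_def petal_tree_def)
  have nz: "\<gamma> t (JA k) - \<gamma> t JO \<noteq> 0" if "t \<in> {0..1}" "k < n" for t k
    using petal_tree_configurationD(1)[OF cfg[OF that(1)] that(2) that(2)] by auto
  have cont_angle: "continuous_on {0..1} (\<lambda>t. petal_angle n (\<gamma> t) k)" if k: "k < n" for k
  proof -
    have "continuous_on {0..1} (\<lambda>t. petal_turn n (\<gamma> t) k)"
      unfolding petal_turn_def using nz k n by (intro continuous_intros) auto
    moreover have "continuous_on ((\<lambda>t. petal_turn n (\<gamma> t) k) ` {0..1}) Arg2pi"
      using petal_turn(2)[OF cfg k n]
      by (intro continuous_at_imp_continuous_on) (auto intro: continuous_at_Arg2pi)
    ultimately have "continuous_on {0..1} (Arg2pi \<circ> (\<lambda>t. petal_turn n (\<gamma> t) k))"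
      by (rule continuous_on_compose)
    then show ?thesis by (simp add: petal_angle_turn o_def)
  qed
  have sum: "(\<Sum>i<n. petal_angle n (\<gamma> t) i) = 2 * pi" if t: "t \<in> {0..1}" for t
  proof -
    \<comment> \<open>The sum is continuous, and any two distinct values differ by at least 2
      pi.\<close>
    have "(\<lambda>t. \<Sum>i<n. petal_angle n (\<gamma> t) i) constant_on {0..1}"
    proof (rule continuous_discrete_range_constant)
      show "continuous_on {0..1} (\<lambda>t. \<Sum>i<n. petal_angle n (\<gamma> t) i)"
        by (intro continuous_intros cont_angle) auto
      fix x :: real assume x: "x \<in> {0..1}"
      have "2 * pi \<le> norm ((\<Sum>i<n. petal_angle n (\<gamma> y) i) - (\<Sum>i<n. petal_angle n (\<gamma> x) i))"
        if y: "y \<in> {0..1}"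
          and ne: "(\<Sum>i<n. petal_angle n (\<gamma> y) i) \<noteq> (\<Sum>i<n. petal_angle n (\<gamma> x) i)" for y
      proof -
        have "cis (\<Sum>i<n. petal_angle n (\<gamma> y) i) = cis (\<Sum>i<n. petal_angle n (\<gamma> x) i)"
          using cis_sum_petal_angle[OF cfg n] x y by simp
        then obtain m :: int where m: "(\<Sum>i<n. petal_angle n (\<gamma> y) i)
            = (\<Sum>i<n. petal_angle n (\<gamma> x) i) + 2 * pi * m"
          using sin_cos_eq_iff by (metis cis.sel)
        with ne have "1 \<le> \<bar>real_of_int m\<bar>" by (cases "m = 0") auto
        then show ?thesis using m by (simp add: abs_mult)
      qed
      then show "\<exists>e>0. \<forall>y. y \<in> {0..1} \<and> (\<Sum>i<n. petal_angle n (\<gamma> y) i)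
            \<noteq> (\<Sum>i<n. petal_angle n (\<gamma> x) i) \<longrightarrow>
          e \<le> norm ((\<Sum>i<n. petal_angle n (\<gamma> y) i) - (\<Sum>i<n. petal_angle n (\<gamma> x) i))"
        by (intro exI[of _ "2 * pi"]) auto
    qed simp
    then show ?thesis using sum t unfolding constant_on_def
      by (metis atLeastAtMost_iff zero_le_one order_refl)
  qed
  show ?thesis
  proof (rule connected_barrier[of "{0..1}" 0 "{..<n}" "\<lambda>k t. petal_slack_at n l1 l2 (\<gamma> t) k"])
    fix k assume k: "k \<in> {..<n}"
    show "continuous_on {0..1} (\<lambda>t. petal_slack_at n l1 l2 (\<gamma> t) k)"
      unfolding petal_slack_at_def using nz k
      by (intro continuous_intros cont_angle) auto
    show "0 < petal_slack_at n l1 l2 (\<gamma> 0) k" using start k by simp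
  next
    fix t :: real and k
    assume t: "t \<in> {0..1}" and k: "k \<in> {..<n}"
      and ge: "\<And>j. j \<in> {..<n} \<Longrightarrow> 0 \<le> petal_slack_at n l1 l2 (\<gamma> t) j"
    show "0 < petal_slack_at n l1 l2 (\<gamma> t) k"
    proof (rule petal_slack_at_pos[OF par cfg[OF t] sum[OF t]])
      show "0 \<le> petal_slack_at n l1 l2 (\<gamma> t) j" if "j < n" for j using ge that by blast
    qed (use k in simp)
  qed (use t i in auto)
qed

lemma not_equivalent_petal_configurations:
  assumes par: "petal_parameters n l1 l2" and p: "petal_configuration n l1 l2 p"
    and start: "\<And>i. i < n \<Longrightarrow> 0 < petal_slack_at n l1 l2 p i"
    and i: "i < n" and q: "petal_angle n q i < alpha n l1"
  shows "\<not> equivalent_configurations (petal_tree n l1 l2) p q"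
proof
  have n: "1 < n" using petal_parameters_bounds(14)[OF par] by simp
  assume "equivalent_configurations (petal_tree n l1 l2) p q"
  then obtain \<gamma> where \<gamma>: "motion (petal_tree n l1 l2) \<gamma>"
    and ends: "\<And>v. v \<in> vertices (petal_tree n l1 l2) \<Longrightarrow> \<gamma> 0 v = p v \<and> \<gamma> 1 v = q v"
    by (auto simp: equivalent_configurations_def)
  \<comment> \<open>A motion is tied to p and q only on the vertices of the tree, hence the
    restriction to \<open>k < n\<close> and the appeal to the previous index staying below
    n.\<close>
  have eq: "\<gamma> 0 JO = p JO" "\<gamma> 1 JO = q JO"
    "k < n \<Longrightarrow> \<gamma> 0 (JA k) = p (JA k)" "k < n \<Longrightarrow> \<gamma> 0 (JB k) = p (JB k)"
    "k < n \<Longrightarrow> \<gamma> 0 (JC k) = p (JC k)" "k < n \<Longrightarrow> \<gamma> 1 (JA k) = q (JA k)" for k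
    using ends by (auto simp: petal_tree_def)
  have 0: "petal_angle n (\<gamma> 0) k = petal_angle n p k"
    "petal_slack_at n l1 l2 (\<gamma> 0) k = petal_slack_at n l1 l2 p k"
    "petal_angle n (\<gamma> 1) k = petal_angle n q k" if "k < n" for k
    using eq(1,2) eq(3-6)[OF that] eq(3,6)[OF previous_petal(1)[OF that n]]
    by (simp_all only: petal_slack_at_def petal_angle_def)
  have "0 < petal_slack_at n l1 l2 (\<gamma> 1) i"
  proof (rule motion_petal_slack_at[OF par \<gamma> _ _ _ i])
    have "(\<Sum>k<n. petal_angle n (\<gamma> 0) k) = (\<Sum>k<n. petal_angle n p k)"
      using 0(1) by (intro sum.cong) auto
    then show "(\<Sum>k<n. petal_angle n (\<gamma> 0) k) = 2 * pi"
      using sum_petal_angle[OF p n] by (rule trans)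
    show "0 < petal_slack_at n l1 l2 (\<gamma> 0) k" if "k < n" for k
      unfolding 0(2)[OF that] by (rule start[OF that])
  qed simp
  then have "theta_m l1 l2 < petal_angle n q i"
    using 0(3)[OF i] by (simp add: petal_slack_at_def petal_slack_iff)
  then show False using par q by (simp add: petal_parameters_def)
qed

section \<open>Points, arc and quadrilateral of a restricted petal\<close>

lemma closed_segment_mult_complex:
  fixes a :: complex
  shows "closed_segment (a * x) (a * y) = (*) a ` closed_segment x y"
  by (rule closed_segment_linear_image) (simp add: bounded_linear.linear bounded_linear_mult_right)

lemma closed_segment_mult_complexI:
  fixes a :: complex
  shows "z \<in> closed_segment x y \<Longrightarrow> a * z \<in> closed_segment (a * x) (a * y)"
  unfolding closed_segment_mult_complex by (rule imageI)

lemma linear_const_on_closed_segment: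
  assumes "linear f" "f x = r" "f y = r" "z \<in> closed_segment x y"
  shows "f z = r"
  using closed_segment_linear_image[OF assms(1), of x y] assms by auto

lemma foot_on_segment_mult:
  assumes "norm a = 1" "0 \<le> Re x" "Re x \<le> 1"
  shows "foot_on_segment (a * x) 0 a (a * of_real (Re x))"
proof -
  have "of_real (Re x) \<in> closed_segment (0::complex) 1"
    using assms closed_segment_of_real[of 0 1] by (auto simp: closed_segment_eq_real_ivl)
  then have "a * of_real (Re x) \<in> closed_segment 0 a"
    using closed_segment_mult_complexI[of _ 0 1 a] by simp
  moreover have "a * x - a * of_real (Re x) = \<i> * of_real (Im x) * a"
    by (subst (1) complex_eq[of x]) (simp add: algebra_simps)
  then have "orthogonal (a * x - a * of_real (Re x)) (a - 0)"
    by (simp only:) (simp add: orthogonal_def inner_complex_def)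
  ultimately show ?thesis by (simp add: foot_on_segment_def)
qed

lemma ccw_angle_mult:
  assumes "a \<noteq> 0"
  shows "ccw_angle (a * c) (a * x) (a * y) = ccw_angle c x y"
  using assms by (simp add: ccw_angle_def flip: right_diff_distrib)

lemma Arg2pi_less_if_Re_less:
  assumes "norm x = 1" "norm y = 1" "0 < Im x" "0 < Im y" "Re y < Re x"
  shows "Arg2pi x < Arg2pi y"
proof (rule ccontr)
  assume "\<not> ?thesis"
  then have "cos (Arg2pi x) \<le> cos (Arg2pi y)"
    using assms by (intro cos_monotone_0_pi_le) (auto simp: Arg2pi_ge_0 Arg2pi_le_pi)
  then show False using cos_Arg2pi[of x] cos_Arg2pi[of y] assms by simp
qed

text \<open>Seen from the centre, e and f are the quotients of P and w by Q. Both lie in the upper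
  half plane, so the arc from Q counterclockwise to P is the small one, and the order along it is
  the reverse order of real parts of e and f.\<close>

lemma open_small_arc_mult:
  assumes a: "norm a = 1" and l: "0 < l" and P: "dist 1 P = l" "Im P < 0"
    and w: "dist 1 w = l" "Im w < 0" "Re w < Re P"
  shows "a * w \<in> open_small_arc a l (a * P) (a * of_real (1 - l))"
proof -
  define e f where "e = (1 - P) / of_real l" and "f = (1 - w) / of_real l"
  have ef: "norm e = 1" "norm f = 1" "0 < Im e" "0 < Im f" "Re e < Re f"
  proof -
    have "Im e = - Im P / l" "Im f = - Im w / l" "Re e = (1 - Re P) / l" "Re f = (1 - Re w) / l"
      by (simp_all add: e_def f_def)
    then show "0 < Im e" "0 < Im f" "Re e < Re f"
      using l P(2) w(2,3) by (simp_all add: divide_neg_pos divide_strict_right_mono)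
    show "norm e = 1" "norm f = 1"
      using l P(1) w(1) by (simp_all add: e_def f_def norm_divide dist_norm)
  qed
  have a0: "a \<noteq> 0" using a by auto
  define Q where "Q = (of_real (1 - l) :: complex)"
  have Q1: "Q - 1 = - of_real l" by (simp add: Q_def)
  have P1: "1 - P \<noteq> 0" using P l by auto
  have angle: "ccw_angle a (a * x) (a * y) = ccw_angle 1 x y" for x y
    using ccw_angle_mult[OF a0, of 1] by simp
  have QP: "ccw_angle 1 Q P = Arg2pi e" "ccw_angle 1 Q w = Arg2pi f"
    using minus_divide_divide[of "1 - P" "of_real l"] minus_divide_divide[of "1 - w" "of_real l"]
    unfolding ccw_angle_def Q1 e_def f_def minus_diff_eq by (simp_all only:)
  have "(Q - 1) / (P - 1) = inverse e"
    unfolding Q1 e_def using P1 l by (simp add: field_simps)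
  then have PQ: "ccw_angle 1 P Q = 2 * pi - Arg2pi e"
    using ef(3) Arg2pi_inverse[of e] by (auto simp: ccw_angle_def complex_is_Real_iff)
  have "Arg2pi e < pi" "0 < Arg2pi f" "Arg2pi f < Arg2pi e"
    using ef Arg2pi_lt_pi[of e] Arg2pi_lt_pi[of f] Arg2pi_less_if_Re_less[of f e] by auto
  moreover have "a * w \<in> sphere a l"
  proof -
    have "dist a (a * w) = norm (a * (1 - w))" by (simp add: dist_norm right_diff_distrib)
    then show ?thesis using a w by (simp add: norm_mult dist_norm)
  qed
  ultimately show ?thesis
    unfolding open_small_arc_def open_ccw_arc_def Q_def[symmetric]
    using QP PQ angle[of P Q] angle[of Q P] angle[of Q w] by simp
qed

text \<open>\<open>l_P\<close> is a root of x^2 - 2 x cos theta + 1 - l1^2, whose roots are the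
  signed distances from O, along the ray at angle theta to OA, to the circle about A.\<close>

lemma l_P_circle:
  assumes "(sin \<theta>)\<^sup>2 \<le> l1\<^sup>2"
  shows "1 - l1\<^sup>2 + (l_P l1 \<theta>)\<^sup>2 = 2 * l_P l1 \<theta> * cos \<theta>"
proof -
  define s where "s = sqrt (l1\<^sup>2 - (sin \<theta>)\<^sup>2)"
  have "s\<^sup>2 = l1\<^sup>2 - (sin \<theta>)\<^sup>2" using assms by (simp add: s_def)
  then have "1 - l1\<^sup>2 = (cos \<theta>)\<^sup>2 - s\<^sup>2" using sin_cos_squared_add[of \<theta>] by simp
  moreover have "l_P l1 \<theta> = cos \<theta> - s" by (simp only: l_P_def s_def)
  ultimately show ?thesis by algebra
qed

lemma dist_ray_unit_circle:
  "(dist a (x *\<^sub>R (a * cis (- \<theta>))))\<^sup>2 = 1 - 2 * x * cos \<theta> + x\<^sup>2" if "norm a = 1"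
proof -
  have "dist a (x *\<^sub>R (a * cis (- \<theta>))) = norm (a * (1 - of_real x * cis (- \<theta>)))"
    by (simp add: dist_norm algebra_simps scaleR_conv_of_real)
  also have "\<dots> = norm (1 - of_real x * cis (- \<theta>))" using that by (simp add: norm_mult)
  finally have "(dist a (x *\<^sub>R (a * cis (- \<theta>))))\<^sup>2 = (1 - x * cos \<theta>)\<^sup>2 + (x * sin \<theta>)\<^sup>2"
    by (simp add: cmod_power2)
  also have "\<dots> = 1 - 2 * x * cos \<theta> + x\<^sup>2 * ((sin \<theta>)\<^sup>2 + (cos \<theta>)\<^sup>2)"
    by algebra
  finally show ?thesis by simp
qed

lemma nearer_intersection_l_P:
  assumes a: "norm a = 1" and l1: "0 < l1" and s: "(sin \<theta>)\<^sup>2 < l1\<^sup>2" and pos: "0 < l_P l1 \<theta>"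
  shows "nearer_intersection 0 (a * cis (- \<theta>)) a l1 (l_P l1 \<theta> *\<^sub>R (a * cis (- \<theta>)))"
proof -
  define x1 where "x1 = l_P l1 \<theta>"
  define x2 where "x2 = cos \<theta> + sqrt (l1\<^sup>2 - (sin \<theta>)\<^sup>2)"
  have roots: "x1 < x2" "x1 + x2 = 2 * cos \<theta>" using s by (auto simp: x1_def x2_def l_P_def)
  have eq1: "1 - 2 * x1 * cos \<theta> + x1\<^sup>2 = l1\<^sup>2"
    using l_P_circle[of \<theta> l1] s by (simp add: x1_def)
  have on: "dist a (x *\<^sub>R (a * cis (- \<theta>))) = l1 \<longleftrightarrow> x = x1 \<or> x = x2" for x
  proof -
    have "dist a (x *\<^sub>R (a * cis (- \<theta>))) = l1 \<longleftrightarrow> (dist a (x *\<^sub>R (a * cis (- \<theta>))))\<^sup>2 = l1\<^sup>2"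
      using l1 by (simp add: power2_eq_iff_nonneg)
    also have "\<dots> \<longleftrightarrow> x\<^sup>2 - x1\<^sup>2 = (x1 + x2) * (x - x1)"
      unfolding dist_ray_unit_circle[OF a] roots(2) using eq1 by (auto simp: algebra_simps)
    also have "\<dots> \<longleftrightarrow> (x - x1) * (x - x2) = 0"
      by (auto simp: power2_eq_square algebra_simps)
    finally show ?thesis by auto
  qed
  have hull: "y \<in> affine hull {0, a * cis (- \<theta>)} \<longleftrightarrow> (\<exists>x. y = x *\<^sub>R (a * cis (- \<theta>)))" for y
    by (auto simp: affine_hull_2) (metis add.commute diff_add_cancel)
  have norm: "dist 0 (x *\<^sub>R (a * cis (- \<theta>))) = \<bar>x\<bar>" for x using a by (simp add: norm_mult)
  show ?thesis
    unfolding nearer_intersection_def x1_def[symmetric]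
  proof (intro conjI ballI)
    show "x1 *\<^sub>R (a * cis (- \<theta>)) \<in> sphere a l1 \<inter> affine hull {0, a * cis (- \<theta>)}"
      using on[of x1] hull by auto
    fix y assume y: "y \<in> sphere a l1 \<inter> affine hull {0, a * cis (- \<theta>)} - {x1 *\<^sub>R (a * cis (- \<theta>))}"
    then obtain x where x: "y = x *\<^sub>R (a * cis (- \<theta>))" using hull by blast
    then have "x = x2" using y on[of x] by auto
    then show "dist 0 (x1 *\<^sub>R (a * cis (- \<theta>))) < dist 0 y"
      unfolding x norm using roots pos by (simp add: x1_def)
  qed
qed

text \<open>The region is compared with the compact convex set \<open>K\<close> cut out by four
  half-planes: its interior is the \<open>inside\<close> of its frontier, and the frontier is
  covered by the four sides. A point strictly inside all half-planes lies off the sides, so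
  monotonicity of \<open>inside\<close> applies.\<close>

lemma mem_inside_quadrilateral:
  assumes a: "a \<noteq> 0" and \<theta>: "0 < \<theta>" "\<theta> < pi"
    and v: "Im v < 0" "0 < Im (v * cis \<theta>)" "Re v < Re w" "Re (v * cis \<theta>) < Re (w * cis \<theta>)"
  defines "R \<equiv> a * cis (- \<theta>) * of_real (Re (w * cis \<theta>))" and "S \<equiv> a * of_real (Re w)"
  shows "a * v \<in> inside (closed_segment 0 R \<union> closed_segment R (a * w)
    \<union> closed_segment (a * w) S \<union> closed_segment S 0)" (is "_ \<in> inside ?G")
proof -
  \<comment> \<open>Multiplication by c or c' turns the direction of OA or of OA', respectively,
    into the positive real axis.\<close>
  define c c' where "c = inverse a" and "c' = cis \<theta> * inverse a"
  have c: "z = a * (z * c)" "z = a * cis (- \<theta>) * (z * c')" "z * c * cis \<theta> = z * c'" for z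
    using a by (auto simp: c_def c'_def cis_mult field_simps)
  have s: "0 < sin \<theta>" using \<theta> by (simp add: sin_gt_zero)
  define K where "K = {z. Im (z * c) \<le> 0 \<and> 0 \<le> Im (z * c') \<and> Re (z * c) \<le> Re w
    \<and> Re (z * c') \<le> Re (w * cis \<theta>)}"
  define U where "U = {z. Im (z * c) < 0 \<and> 0 < Im (z * c') \<and> Re (z * c) < Re w
    \<and> Re (z * c') < Re (w * cis \<theta>)}"
  have "open U" unfolding U_def by (intro open_Collect_conj open_Collect_less continuous_intros)
  moreover have "U \<subseteq> K" by (auto simp: U_def K_def)
  ultimately have U: "U \<subseteq> interior K" by (rule interior_maximal[rotated])
  have "closed K" unfolding K_def by (intro closed_Collect_conj closed_Collect_le continuous_intros)
  have "convex K"
  proof -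
    have vimage: "convex ((\<lambda>z. z * d) -` H)" if "convex H" for d and H :: "complex set"
      using that by (intro convex_linear_vimage) (auto intro: bounded_linear.linear bounded_linear_mult_left)
    have "convex ((\<lambda>z. z * c) -` {z. Im z \<le> 0} \<inter> (\<lambda>z. z * c') -` {z. Im z \<ge> 0}
        \<inter> (\<lambda>z. z * c) -` {z. Re z \<le> Re w} \<inter> (\<lambda>z. z * c') -` {z. Re z \<le> Re (w * cis \<theta>)})"
      by (intro convex_Int vimage convex_halfspace_Im_le convex_halfspace_Im_ge convex_halfspace_Re_le)
    also have "\<dots> = K" by (auto simp: K_def)
    finally show ?thesis .
  qed
  have "bounded K"
  proof (rule boundedI)
    fix z assume "z \<in> K"
    then have "(norm (z * c))\<^sup>2 + (dist (z * c) w)\<^sup>2 \<le> (norm w)\<^sup>2"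
      using \<theta> by (intro norm_quadrilateral_le[of \<theta>]) (auto simp: K_def c(3) simp del: times_complex.sel)
    then have "(norm (z * c))\<^sup>2 \<le> (norm w)\<^sup>2" by (smt (verit) zero_le_power2)
    then have "norm (z * c) \<le> norm w" by (rule power2_le_imp_le) simp
    then have "norm a * norm (z * c) \<le> norm a * norm w" by (simp add: mult_left_mono)
    then show "norm z \<le> norm a * norm w" using c(1)[of z] by (metis norm_mult)
  qed
  have "frontier K \<subseteq> ?G"
  proof
    fix z assume "z \<in> frontier K"
    then have z: "z \<in> K" "z \<notin> U" using U \<open>closed K\<close> by (auto simp: frontier_def)
    define x y where "x = z * c" and "y = z * c'"
    have yx: "y = x * cis \<theta>" and zx: "z = a * x" and zy: "z = a * cis (- \<theta>) * y"
      unfolding x_def y_def using c[of z] by metis+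
    have ge: "Im x \<le> 0" "0 \<le> Im y" "Re x \<le> Re w" "Re y \<le> Re (w * cis \<theta>)"
      using z by (simp_all add: K_def x_def y_def del: times_complex.sel)
    have xy: "x = y * cis (- \<theta>)" by (simp add: yx cis_mult mult.assoc)
    consider "Im x = 0" | "Im y = 0" | "Re x = Re w" | "Re y = Re (w * cis \<theta>)"
      using z ge by (auto simp: U_def x_def y_def simp del: times_complex.sel)
    then show "z \<in> ?G"
    proof cases
      case 1
      then have "0 \<le> Re x" using ge(2) s by (simp add: yx zero_le_mult_iff)
      then have "x \<in> closed_segment (of_real (Re w)) 0"
        using 1 ge by (simp add: closed_segment_same_Im closed_segment_eq_real_ivl)
      then have "z \<in> closed_segment S 0"
        using closed_segment_mult_complexI[of x "of_real (Re w)" 0 a] by (simp add: zx S_def)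
      then show ?thesis by simp
    next
      case 2
      then have "0 \<le> Re y" using ge(1) s by (simp add: xy mult_le_0_iff zero_le_mult_iff)
      then have "y \<in> closed_segment 0 (of_real (Re (w * cis \<theta>)))"
        using 2 ge by (simp add: closed_segment_same_Im closed_segment_eq_real_ivl)
      then have "z \<in> closed_segment 0 R"
        using closed_segment_mult_complexI[of y _ _ "a * cis (- \<theta>)"]
        unfolding zy R_def by (metis mult_zero_right)
      then show ?thesis by simp
    next
      case 3
      then have "0 \<le> (Im x - Im w) * sin \<theta>" using ge(4) by (simp add: yx algebra_simps)
      then have "Im w \<le> Im x" using s by (simp add: zero_le_mult_iff)
      then have "x \<in> closed_segment w (of_real (Re w))"
        using 3 ge by (simp add: closed_segment_same_Re closed_segment_eq_real_ivl)
      then have "z \<in> closed_segment (a * w) S"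
        using closed_segment_mult_complexI[of x w "of_real (Re w)" a] by (simp add: zx S_def)
      then show ?thesis by simp
    next
      case 4
      define w' where "w' = w * cis \<theta>"
      have w: "w = w' * cis (- \<theta>)" by (simp add: w'_def cis_mult mult.assoc)
      have "0 \<le> (Im w' - Im y) * sin \<theta>"
        using ge(3) 4 unfolding w'_def[symmetric] by (simp add: xy w algebra_simps)
      then have "Im y \<le> Im w'" using s by (simp add: zero_le_mult_iff)
      then have "y \<in> closed_segment (of_real (Re w')) w'"
        using 4 ge unfolding w'_def[symmetric]
        by (simp add: closed_segment_same_Re closed_segment_eq_real_ivl)
      then have "a * cis (- \<theta>) * y \<in> closed_segment (a * cis (- \<theta>) * of_real (Re w')) (a * cis (- \<theta>) * w')"
        by (rule closed_segment_mult_complexI)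
      moreover have "a * cis (- \<theta>) * w' = a * w" unfolding w by (simp add: mult_ac)
      ultimately have "z \<in> closed_segment R (a * w)" unfolding zy R_def w'_def[symmetric] by metis
      then show ?thesis by simp
    qed
  qed
  then have sub: "inside (frontier K) - ?G \<subseteq> inside ?G" by (rule inside_mono)
  have av: "a * v * c = v" "a * v * c' = v * cis \<theta>" using a by (simp_all add: c_def c'_def)
  have "a * v \<in> U" using v unfolding U_def mem_Collect_eq av by blast
  then have "a * v \<in> inside (frontier K)"
    using U inside_frontier_eq_interior[OF \<open>bounded K\<close> \<open>convex K\<close>] by auto
  moreover have "a * v \<notin> ?G"
  proof
    assume "a * v \<in> ?G"
    \<comment> \<open>Along each side one of the four defining linear forms is constant at its
      bound, whereas \<open>v\<close> satisfies all four strictly.\<close>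
    have lin: "linear (\<lambda>z. Re (z * d))" "linear (\<lambda>z. Im (z * d))" for d
      by (auto intro!: linearI simp: algebra_simps)
    have ends: "R * c' = of_real (Re (w * cis \<theta>))" "a * w * c' = w * cis \<theta>"
      "a * w * c = w" "S * c = of_real (Re w)"
      using a by (simp_all add: R_def S_def c_def c'_def cis_mult field_simps del: times_complex.sel)
    have "Im (z * c') = 0" if "z \<in> closed_segment 0 R" for z
      by (rule linear_const_on_closed_segment[OF lin(2) _ _ that]) (simp_all add: ends del: times_complex.sel)
    moreover have "Re (z * c') = Re (w * cis \<theta>)" if "z \<in> closed_segment R (a * w)" for z
      by (rule linear_const_on_closed_segment[OF lin(1) _ _ that]) (simp_all add: ends del: times_complex.sel)
    moreover have "Re (z * c) = Re w" if "z \<in> closed_segment (a * w) S" for z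
      by (rule linear_const_on_closed_segment[OF lin(1) _ _ that]) (simp_all add: ends del: times_complex.sel)
    moreover have "Im (z * c) = 0" if "z \<in> closed_segment S 0" for z
      by (rule linear_const_on_closed_segment[OF lin(2) _ _ that]) (simp_all add: ends del: times_complex.sel)
    ultimately have "Im (a * v * c') = 0 \<or> Re (a * v * c') = Re (w * cis \<theta>)
        \<or> Re (a * v * c) = Re w \<or> Im (a * v * c) = 0"
      using \<open>a * v \<in> ?G\<close> by blast
    then show False using v unfolding av by linarith
  qed
  ultimately show ?thesis using sub by blast
qed

section \<open>The petal tree and its rotationally symmetric configurations\<close>

text \<open>A certificate for trees: following parents lowers the depth, so everything is joined to
  the root. A deepest vertex of a cycle would have its parent as both neighbours, which are distinct
  in a cycle of length at least 3.\<close>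

lemma is_tree_parent:
  fixes root :: "'v" and up :: "'v \<Rightarrow> 'v" and depth :: "'v \<Rightarrow> nat"
  assumes V: "finite V" "root \<in> V"
    and E: "E = (\<lambda>v. {v, up v}) ` (V - {root})"
    and parent: "\<And>v. v \<in> V - {root} \<Longrightarrow> up v \<in> V \<and> depth (up v) < depth v"
  shows "is_tree V E"
proof -
  let ?r = "{(x, y). {x, y} \<in> E}"
  have pe: "(v, up v) \<in> ?r" "(up v, v) \<in> ?r" if "v \<in> V - {root}" for v
    using that by (auto simp: E insert_commute)
  have root: "(v, root) \<in> ?r\<^sup>* \<and> (root, v) \<in> ?r\<^sup>*" if "v \<in> V" for v
    using that
  proof (induction "depth v" arbitrary: v rule: less_induct)
    case less
    show ?case
    proof (cases "v = root")
      case False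
      then have v: "v \<in> V - {root}" using less.prems by simp
      then have "(up v, root) \<in> ?r\<^sup>* \<and> (root, up v) \<in> ?r\<^sup>*"
        using less.hyps parent by blast
      then show ?thesis
        using pe[OF v] by (meson converse_rtrancl_into_rtrancl rtrancl.rtrancl_into_rtrancl)
    qed simp
  qed
  have "False" if d: "distinct vs" and m: "3 \<le> length vs"
    and cyc: "\<forall>i<length vs. {vs ! i, vs ! (Suc i mod length vs)} \<in> E" for vs
  proof -
    let ?m = "length vs"
    let ?D = "(\<lambda>i. depth (vs ! i)) ` {..<?m}"
    have "Max ?D \<in> ?D" using m by (intro Max_in) (auto simp: lessThan_empty_iff)
    then obtain i where i: "i < ?m" "depth (vs ! i) = Max ?D" by auto
    have top: "depth (vs ! j) \<le> depth (vs ! i)" if "j < ?m" for j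
      unfolding i(2) using that by (intro Max_ge) auto
    text \<open>Both neighbours of a deepest vertex of the cycle are its parent.\<close>
    have par: "vs ! j = up (vs ! i)" if j: "j < ?m" and e: "{vs ! i, vs ! j} \<in> E" for j
    proof -
      obtain v where v: "v \<in> V - {root}" "{vs ! i, vs ! j} = {v, up v}"
        using e by (auto simp: E)
      then show ?thesis using parent[OF v(1)] top[OF j] by (auto simp: doubleton_eq_iff)
    qed
    define j k where "j = Suc i mod ?m" and "k = (i + ?m - 1) mod ?m"
    have jk: "j < ?m" "k < ?m" using m unfolding j_def k_def by (intro mod_less_divisor; linarith)+
    have "Suc (i + ?m - 1) = i + ?m" using m by simp
    then have "Suc k mod ?m = i" using i unfolding k_def mod_Suc_eq by simp
    then have "{vs ! i, vs ! k} \<in> E" using cyc jk by (metis insert_commute)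
    moreover have "{vs ! i, vs ! j} \<in> E" using cyc i by (simp add: j_def)
    ultimately have "vs ! j = vs ! k" using par jk by metis
    then have "j = k" using d jk by (simp add: nth_eq_iff_index_eq)
    moreover have "j = (if Suc i = ?m then 0 else Suc i)" using i by (simp add: j_def)
    moreover have "k = (if i = 0 then ?m - 1 else i - 1)"
    proof (cases i)
      case (Suc i')
      then have "i + ?m - 1 = i' + ?m" by simp
      then show ?thesis using Suc i by (simp add: k_def del: add_Suc)
    qed (use m in \<open>auto simp: k_def\<close>)
    ultimately show False using m i by (auto split: if_splits)
  qed
  moreover have "e \<subseteq> V \<and> card e = 2" if e: "e \<in> E" for e
  proof -
    obtain v where v: "v \<in> V - {root}" "e = {v, up v}" using e by (auto simp: E)
    then have "v \<noteq> up v" using parent by fastforce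
    then show ?thesis using v parent by (simp add: card_insert_if)
  qed
  moreover have "(u, v) \<in> ?r\<^sup>*" if "u \<in> V" "v \<in> V" for u v
    using root[OF that(1)] root[OF that(2)] by (meson rtrancl_trans)
  ultimately show ?thesis
    unfolding is_tree_def using V by (intro conjI ballI notI; (elim exE conjE)?) blast+
qed

lemma tree_linkage_petal_tree:
  assumes "0 < l1" "0 < l2"
  shows "tree_linkage (petal_tree n l1 l2)"
proof -
  define up where "up v = (case v of JB i \<Rightarrow> JA i | JC i \<Rightarrow> JB i | _ \<Rightarrow> JO)" for v
  define depth :: "petal_vertex \<Rightarrow> nat"
    where "depth v = (case v of JO \<Rightarrow> 0 | JA _ \<Rightarrow> 1 | JB _ \<Rightarrow> 2 | JC _ \<Rightarrow> 3)" for v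
  have "is_tree (vertices (petal_tree n l1 l2)) (edges (petal_tree n l1 l2))"
  proof (rule is_tree_parent[where root = JO and up = up and depth = depth])
    let ?I = "{..<n}"
    have "vertices (petal_tree n l1 l2) - {JO} = JA ` ?I \<union> JB ` ?I \<union> JC ` ?I"
      by (auto simp: petal_tree_def)
    then show "edges (petal_tree n l1 l2)
        = (\<lambda>v. {v, up v}) ` (vertices (petal_tree n l1 l2) - {JO})"
      by (auto simp: petal_tree_def up_def image_Un image_image insert_commute)
  qed (auto simp: petal_tree_def up_def depth_def)
  then show ?thesis using assms by (simp add: tree_linkage_def petal_tree_def)
qed

section \<open>Rotated copies of one petal in disjoint sectors\<close>

lemma Arg2pi_cis: "0 \<le> x \<Longrightarrow> x < 2 * pi \<Longrightarrow> Arg2pi (cis x) = x"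
  by (simp add: cis_conv_exp Arg2pi_exp)

text \<open>A sector clockwise from the positive real axis, without its apex and closed on one side
  only, so that adjacent rotated copies are disjoint though each contains its own link OA away from
  O.\<close>

definition wedge :: "real \<Rightarrow> complex set" where
  "wedge \<delta> = {of_real y * cis (- \<psi>) | y \<psi>. 0 < y \<and> 0 \<le> \<psi> \<and> \<psi> < \<delta>}"

lemma of_real_in_wedge: "0 < y \<Longrightarrow> 0 < \<delta> \<Longrightarrow> of_real y \<in> wedge \<delta>"
  unfolding wedge_def by (intro CollectI exI[of _ y] exI[of _ 0]) simp

text \<open>Equal points have angles s, t differing by a multiple of 2 pi; both range over less than
  one turn, so s = t, and then (i - j) \<open>\<delta>\<close> would be smaller than
  \<open>\<delta>\<close> in absolute value.\<close>

lemma wedge_rotated_disjoint: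
  assumes n: "real n * \<delta> \<le> 2 * pi" "i < n" "j < n" "i \<noteq> j" and z: "z \<in> wedge \<delta>" "z' \<in> wedge \<delta>"
  shows "cis (real i * \<delta>) * z \<noteq> cis (real j * \<delta>) * z'"
proof
  assume eq: "cis (real i * \<delta>) * z = cis (real j * \<delta>) * z'"
  obtain y \<psi> where y: "z = of_real y * cis (- \<psi>)" "0 < y" "0 \<le> \<psi>" "\<psi> < \<delta>"
    using z by (auto simp: wedge_def)
  obtain y' \<psi>' where y': "z' = of_real y' * cis (- \<psi>')" "0 < y'" "0 \<le> \<psi>'" "\<psi>' < \<delta>"
    using z by (auto simp: wedge_def)
  have "norm z = norm z'" using arg_cong[OF eq, of norm] by (simp add: norm_mult)
  then have "y = y'" using y y' by (simp add: norm_mult)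
  define s t where "s = real i * \<delta> - \<psi>" and "t = real j * \<delta> - \<psi>'"
  have "of_real y * cis s = of_real y * cis t"
    using eq y(1) y'(1) \<open>y = y'\<close> by (simp add: s_def t_def cis_mult algebra_simps)
  then have "cis s = cis t" using y by simp
  then obtain m :: int where m: "s = t + 2 * pi * m"
    using sin_cos_eq_iff by (metis cis.sel)
  have d: "0 < \<delta>" using y by linarith
  have lt: "real a * \<delta> - \<phi> < real b * \<delta> - \<phi>' + 2 * pi"
    if "a < n" "0 \<le> \<phi>" "\<phi>' < \<delta>" for a b \<phi> \<phi>'
  proof -
    have "real a * \<delta> \<le> (real n - 1) * \<delta>" using that d by (intro mult_right_mono) auto
    moreover have "0 \<le> real b * \<delta>" using d by simp
    ultimately show ?thesis using n that by (simp add: algebra_simps)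
  qed
  have "s < t + 2 * pi" "t < s + 2 * pi"
    using lt y y' n unfolding s_def t_def by blast+
  then have "2 * pi * m < 2 * pi * 1" "2 * pi * (- 1) < 2 * pi * m" using m by linarith+
  then have "real_of_int m < 1" "-1 < real_of_int m"
    using mult_less_cancel_left_pos[of "2 * pi"] pi_gt_zero by fastforce+
  then have "m = 0" by linarith
  then have "\<bar>(real i - real j) * \<delta>\<bar> < 1 * \<delta>"
    using m y y' by (auto simp: s_def t_def algebra_simps abs_if)
  then have "\<bar>real i - real j\<bar> < 1" using d by (simp add: abs_mult)
  then show False using n by linarith
qed

primrec fan :: "real \<Rightarrow> complex \<Rightarrow> complex \<Rightarrow> petal_vertex \<Rightarrow> complex" where
  "fan \<delta> w v JO = 0"
| "fan \<delta> w v (JA i) = cis (real i * \<delta>)"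
| "fan \<delta> w v (JB i) = cis (real i * \<delta>) * w"
| "fan \<delta> w v (JC i) = cis (real i * \<delta>) * v"

text \<open>Different petals can meet only at O because each occupies its own wedge, so simplicity
  reduces to the three links of a single petal.\<close>

lemma petal_configuration_fan:
  assumes \<delta>: "0 < \<delta>" "real n * \<delta> \<le> 2 * pi" and l: "dist 1 w = l1" "dist w v = l2"
    and seg: "closed_segment 0 1 \<inter> closed_segment 1 w = {1}"
      "closed_segment 1 w \<inter> closed_segment w v = {w}"
      "closed_segment 0 1 \<inter> closed_segment w v = {}"
    and wedge: "closed_segment 1 w \<subseteq> wedge \<delta>" "closed_segment w v \<subseteq> wedge \<delta>"
  shows "petal_configuration n l1 l2 (fan \<delta> w v)"
proof -
  let ?p = "fan \<delta> w v" and ?T = "petal_tree n l1 l2"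
  define r where "r i = cis (real i * \<delta>)" for i
  define S where "S k = (if k = 0 then closed_segment 0 1 else
    if k = 1 then closed_segment 1 w else closed_segment w v)" for k :: nat
  define e where "e i k = (if k = 0 then {JO, JA i} else if k = 1 then {JA i, JB i} else {JB i, JC i})"
    for i and k :: nat
  have r0: "r i \<noteq> 0" for i by (simp add: r_def)
  have link: "link ?p (e i k) = (*) (r i) ` S k" for i k
    using closed_segment_mult_complex[of "r i"]
    by (auto simp: e_def link_edge S_def r_def simp flip: closed_segment_mult_complex)
  have edge: "f \<in> edges ?T \<longleftrightarrow> (\<exists>i<n. \<exists>k<3. f = e i k)" for f
    by (auto simp: petal_tree_def e_def numeral_3_eq_3 less_Suc_eq)
  have S0: "closed_segment 0 1 - {0} \<subseteq> wedge \<delta>"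
  proof
    fix x :: complex assume x: "x \<in> closed_segment 0 1 - {0}"
    then obtain y where "0 < y" "x = of_real y"
      by (auto simp: in_segment scaleR_conv_of_real)
    then show "x \<in> wedge \<delta>" using \<delta> by (simp add: of_real_in_wedge)
  qed
  have apart: "(*) (r i) ` S k \<inter> (*) (r j) ` S m = (if k = 0 \<and> m = 0 then {0} else {})"
    if "i < n" "j < n" "i \<noteq> j" for i j k m
  proof -
    have w: "S k - (if k = 0 then {0} else {}) \<subseteq> wedge \<delta>" for k
      using S0 wedge by (auto simp: S_def)
    have "x = 0 \<and> y = 0 \<and> k = 0 \<and> m = 0"
      if x: "x \<in> S k" "y \<in> S m" and eq: "r i * x = r j * y" for x y
    proof -
      have "x = 0 \<longleftrightarrow> y = 0" using eq r0 by (metis mult_eq_0_iff)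
      moreover have "x \<notin> wedge \<delta> \<or> y \<notin> wedge \<delta>"
        using wedge_rotated_disjoint[OF \<delta>(2) \<open>i < n\<close> \<open>j < n\<close> \<open>i \<noteq> j\<close>] eq unfolding r_def by blast
      moreover have "0 \<notin> wedge \<delta>" by (auto simp: wedge_def)
      ultimately show ?thesis using w[of k] w[of m] x by (auto split: if_splits)
    qed
    moreover have "0 \<in> S 0" by (simp add: S_def)
    ultimately show ?thesis by (force split: if_splits)
  qed
  have same: "(*) (r i) ` S k \<inter> (*) (r i) ` S m = (*) (r i) ` (S k \<inter> S m)" for i k m
    using r0 by (intro image_Int[symmetric]) (auto simp: inj_on_def)
  have "dist (?p u) (?p x) = edge_label ?T {u, x}" if "{u, x} \<in> edges ?T" for u x
  proof -
    have "\<exists>i. {u, x} = {JO, JA i} \<or> {u, x} = {JA i, JB i} \<or> {u, x} = {JB i, JC i}"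
      using that unfolding petal_tree_def by fastforce
    then obtain i
      where "{u, x} = {JO, JA i} \<or> {u, x} = {JA i, JB i} \<or> {u, x} = {JB i, JC i}" by blast
    moreover have "edge_label ?T {JO, JA i} = 1" "edge_label ?T {JA i, JB i} = l1"
      "edge_label ?T {JB i, JC i} = l2"
      by (auto simp: petal_tree_def doubleton_eq_iff)
    moreover have rot: "dist (r i * x) (r i * y) = dist x y" for x y
      by (simp add: dist_norm norm_mult r_def flip: right_diff_distrib)
    have "dist (?p JO) (?p (JA i)) = 1"
      "dist (?p (JA i)) (?p (JB i)) = l1" "dist (?p (JB i)) (?p (JC i)) = l2"
      using rot[of 1 w] rot[of w v] l by (simp_all add: r_def)
    moreover have "dist (?p u) (?p x) = dist (?p u') (?p x')" if "{u, x} = {u', x'}" for u' x'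
      using that by (auto simp: doubleton_eq_iff dist_commute)
    ultimately show ?thesis by metis
  qed
  moreover have "link ?p f \<inter> link ?p g = {?p x}"
    if fg: "f \<in> edges ?T" "g \<in> edges ?T" and x: "f \<inter> g = {x}" for f g x
  proof -
    obtain i k j m where *: "i < n" "k < 3" "f = e i k" "j < n" "m < 3" "g = e j m"
      using fg[unfolded edge] by (elim exE conjE) rule
    show ?thesis
    proof (cases "i = j")
      case True
      have km: "k = 0 \<or> k = 1 \<or> k = 2" "m = 0 \<or> m = 1 \<or> m = 2" using * by linarith+
      have "S k \<inter> S m = {1} \<and> x = JA i \<or> S k \<inter> S m = {w} \<and> x = JB i"
        using km x seg(1,2) seg(1,2)[THEN trans[OF Int_commute]]
        unfolding *(3,6) True[symmetric] by (elim disjE; force simp: e_def S_def)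
      then show ?thesis
        unfolding * link True[symmetric] same by (elim disjE conjE) (simp_all add: r_def)
    next
      case False
      then have "k = 0" "m = 0" "x = JO" using x by (auto simp: * e_def split: if_splits)
      then show ?thesis using apart False * by (simp add: link)
    qed
  qed
  moreover have "link ?p f \<inter> link ?p g = {}"
    if fg: "f \<in> edges ?T" "g \<in> edges ?T" and x: "f \<inter> g = {}" for f g
  proof -
    obtain i k j m where *: "i < n" "k < 3" "f = e i k" "j < n" "m < 3" "g = e j m"
      using fg[unfolded edge] by (elim exE conjE) rule
    show ?thesis
    proof (cases "i = j")
      case True
      then have "k = 0 \<and> m = 2 \<or> k = 2 \<and> m = 0"
        using x * by (auto simp: e_def split: if_splits)
      then have "S k \<inter> S m = {}" using seg(3) by (auto simp: S_def)
      then show ?thesis unfolding * link True[symmetric] same by simp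
    next
      case False
      then have "\<not> (k = 0 \<and> m = 0)" using x by (auto simp: * e_def split: if_splits)
      then show ?thesis using apart[of i j k m] False * by (auto simp: link)
    qed
  qed
  moreover have "ccw_angle (?p JO) (?p (JA 0)) (?p (JA i)) = real i * \<delta>" if "i < n" for i
  proof -
    have "real i * \<delta> < real n * \<delta>" using that \<delta> by simp
    then have "real i * \<delta> < 2 * pi" using \<delta> by linarith
    then show ?thesis using \<delta> by (simp add: ccw_angle_def Arg2pi_cis)
  qed
  ultimately show ?thesis using \<delta> by (auto simp: petal_configuration_def configuration_def)
qed

text \<open>The previous index wraps around at \<open>i = 0\<close>, where the turn is
  \<open>\<delta>\<close> because the fan closes up; for other indices a gap is harmless.\<close>

lemma fan_turn:
  assumes i: "i < n" and w: "0 < i \<or> real n * \<delta> = 2 * pi"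
  shows "cis (real i * \<delta>) = cis (real ((i + n - 1) mod n) * \<delta>) * cis \<delta>"
proof (cases i)
  case 0
  then have "(i + n - 1) mod n = n - 1" using i by simp
  moreover have "real (n - 1) * \<delta> + \<delta> = 2 * pi" using 0 w i by (simp add: of_nat_diff algebra_simps)
  ultimately show ?thesis using 0 by (simp add: cis_mult)
next
  case (Suc i')
  then have "i + n - 1 = i' + n" by simp
  then have "(i + n - 1) mod n = i'" using i Suc by simp
  then show ?thesis using Suc by (simp add: cis_mult algebra_simps)
qed

lemma petal_angle_fan:
  assumes "i < n" "0 < i \<or> real n * \<delta> = 2 * pi" "0 < \<delta>" "\<delta> < 2 * pi"
  shows "petal_angle n (fan \<delta> w v) i = \<delta>"
  unfolding petal_angle_def ccw_angle_def using assms
  by (simp add: fan_turn[OF assms(1,2)] Arg2pi_cis)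

lemma petal_configuration_straight_fan:
  fixes x y :: real
  assumes "0 < \<delta>" "real n * \<delta> \<le> 2 * pi" "1 < x" "x < y"
  shows "petal_configuration n (x - 1) (y - x) (fan \<delta> (of_real x) (of_real y))"
proof (rule petal_configuration_fan)
  have seg: "closed_segment (0::complex) 1 = of_real ` {0..1}"
    "closed_segment (1::complex) (of_real x) = of_real ` {1..x}"
    "closed_segment (of_real x) (of_real y :: complex) = of_real ` {x..y}"
    using closed_segment_of_real[of 0 1] closed_segment_of_real[of 1 x]
      closed_segment_of_real[of x y] assms
    by (simp_all add: closed_segment_eq_real_ivl)
  have int: "of_real ` A \<inter> of_real ` B = (of_real ` (A \<inter> B) :: complex set)" for A B
    by (rule image_Int[symmetric]) (rule inj_of_real)
  have "{0..1} \<inter> {1..x} = {1}" "{1..x} \<inter> {x..y} = {x}" "{0..1} \<inter> {x..y} = {}"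
    using assms by auto
  then show "closed_segment (0::complex) 1 \<inter> closed_segment 1 (of_real x) = {1}"
    "closed_segment 1 (of_real x) \<inter> closed_segment (of_real x) (of_real y) = {of_real x :: complex}"
    "closed_segment (0::complex) 1 \<inter> closed_segment (of_real x) (of_real y) = {}"
    unfolding seg int by simp_all
  show "closed_segment 1 (of_real x) \<subseteq> wedge \<delta>"
    "closed_segment (of_real x) (of_real y) \<subseteq> wedge \<delta>"
    unfolding seg using assms by (auto intro!: of_real_in_wedge)
  show "dist (1::complex) (of_real x) = x - 1"
    using assms dist_of_real[of 1 x, where 'a = complex] by (simp add: dist_real_def)
  show "dist (of_real x :: complex) (of_real y) = y - x"
    using assms by (simp add: dist_of_real dist_real_def)
qed (use assms in auto)

text \<open>BC is folded back onto OB, with C still at positive distance from O. The links OA and BC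
  lie on different rays, and AB meets each ray only at its own end, as imaginary parts show.\<close>

lemma petal_configuration_folded_fan:
  assumes \<delta>: "real n * \<delta> \<le> 2 * pi" and \<phi>: "0 < \<phi>" "\<phi> < \<delta>" "\<phi> < pi" and r: "0 < l2" "l2 < r"
  defines "u \<equiv> cis (- \<phi>)"
  shows "petal_configuration n (dist 1 (of_real r * u)) l2 (fan \<delta> (of_real r * u) (of_real (r - l2) * u))"
proof (rule petal_configuration_fan)
  let ?w = "of_real r * u" and ?v = "of_real (r - l2) * u"
  have u: "u * cis \<phi> = 1" "norm u = 1" "Im u < 0"
    using \<phi> by (simp_all add: u_def cis_mult sin_gt_zero)
  have s0: "\<exists>y. z = of_real y" if "z \<in> closed_segment 0 1" for z :: complex
    using that by (auto simp: in_segment scaleR_conv_of_real)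
  have s1: "\<exists>t. 0 \<le> t \<and> t \<le> 1 \<and> z = of_real (1 - t) + of_real (t * r) * u"
    if "z \<in> closed_segment 1 ?w" for z
    using that by (auto simp: in_segment scaleR_conv_of_real mult.assoc)
  have s2: "\<exists>y. 0 < y \<and> z = of_real y * u" if z: "z \<in> closed_segment ?w ?v" for z
  proof -
    obtain t where t: "0 \<le> t" "t \<le> 1" "z = (1 - t) *\<^sub>R ?w + t *\<^sub>R ?v"
      using z by (auto simp: in_segment)
    have "z = of_real (r - t * l2) * u" by (simp add: t(3) scaleR_conv_of_real algebra_simps)
    moreover have "t * l2 \<le> 1 * l2" using t r by (intro mult_right_mono) auto
    then have "0 < r - t * l2" using r by linarith
    ultimately show ?thesis by blast
  qed
  show "closed_segment 0 1 \<inter> closed_segment 1 ?w = {1}"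
  proof (intro equalityI subsetI)
    fix z assume z: "z \<in> closed_segment 0 1 \<inter> closed_segment 1 ?w"
    then obtain t y where t: "z = of_real (1 - t) + of_real (t * r) * u" and y: "z = of_real y"
      using s0 s1 by blast
    have "Im z = t * r * Im u" by (simp add: t)
    moreover have "Im z = 0" by (simp add: y)
    ultimately have "t = 0" using u r by simp
    then show "z \<in> {1}" by (simp add: t)
  qed simp
  show "closed_segment 1 ?w \<inter> closed_segment ?w ?v = {?w}"
  proof (intro equalityI subsetI)
    fix z assume z: "z \<in> closed_segment 1 ?w \<inter> closed_segment ?w ?v"
    then obtain t y where t: "z = of_real (1 - t) + of_real (t * r) * u" and y: "z = of_real y * u"
      using s1 s2 by blast
    then have "of_real (1 - t) = of_real (y - t * r) * u" by (simp add: algebra_simps)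
    then have "Im (of_real (1 - t)) = Im (of_real (y - t * r) * u)" by (rule arg_cong)
    then have "y - t * r = 0" using u by simp
    with \<open>of_real (1 - t) = of_real (y - t * r) * u\<close> have "1 - t = 0" by (metis mult_zero_left of_real_0 of_real_eq_0_iff)
    then show "z \<in> {?w}" by (simp add: t)
  qed simp
  show "closed_segment 0 1 \<inter> closed_segment ?w ?v = {}"
  proof (rule ccontr)
    assume "\<not> ?thesis"
    then obtain z x y where "z = of_real x" "z = of_real y * u" and y: "0 < y" using s0 s2 by blast
    then have "Im (of_real x) = Im (of_real y * u)" by simp
    then show False using u y by simp
  qed
  show "closed_segment ?w ?v \<subseteq> wedge \<delta>"
    using s2 \<phi> unfolding wedge_def u_def by (fastforce intro: less_imp_le)
  show "closed_segment 1 ?w \<subseteq> wedge \<delta>"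
  proof
    fix z assume "z \<in> closed_segment 1 ?w"
    then obtain t where t: "0 \<le> t" "t \<le> 1" and z: "z = of_real (1 - t) + of_real (t * r) * u"
      using s1 by blast
    have Im: "Im z = t * r * Im u" by (simp add: z)
    have "z * cis \<phi> = of_real (1 - t) * cis \<phi> + of_real (t * r) * (u * cis \<phi>)"
      by (simp add: z algebra_simps)
    then have "Im (z * cis \<phi>) = (1 - t) * sin \<phi>" by (simp add: u)
    moreover have "z \<noteq> 0"
    proof
      assume "z = 0"
      then have "t = 0" using Im u r by simp
      then show False using \<open>z = 0\<close> z by simp
    qed
    ultimately obtain \<psi> where "0 \<le> \<psi>" "\<psi> \<le> \<phi>" "z = of_real (norm z) * cis (- \<psi>)"
      using wedge_polar[of z \<phi>] \<phi> t r u Im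
      by (auto simp: mult_nonneg_nonpos sin_ge_zero simp del: times_complex.sel)
    then show "z \<in> wedge \<delta>" using \<phi> \<open>z \<noteq> 0\<close> unfolding wedge_def
      by (intro CollectI exI[of _ "norm z"] exI[of _ \<psi>]) simp
  qed
  show "dist ?w ?v = l2" using r u by (simp add: dist_norm norm_mult flip: left_diff_distrib of_real_diff)
qed (use assms in auto)

section \<open>The two configurations\<close>

lemma chord_triangle:
  assumes "0 < r" "1 - r < l1" "r < 1" "(1 - l1\<^sup>2 + r\<^sup>2) / (2 * r) > 0"
  obtains \<phi> where "0 < \<phi>" "\<phi> < pi / 2" "cos \<phi> = (1 - l1\<^sup>2 + r\<^sup>2) / (2 * r)"
    "dist 1 (of_real r * cis (- \<phi>)) = l1"
proof
  define c where "c = (1 - l1\<^sup>2 + r\<^sup>2) / (2 * r)"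
  have "(1 - r) * (1 - r) < l1 * l1" using assms by (intro mult_strict_mono) auto
  then have c: "0 < c" "c < 1"
    using assms by (simp_all add: c_def divide_simps power2_eq_square algebra_simps)
  then show cos: "cos (arccos c) = c" by simp
  show "0 < arccos c" using c arccos_lt_bounded[of c] by simp
  show "arccos c < pi / 2" using arccos_less_arccos[of 0 c] c by simp
  have "(dist 1 (of_real r * cis (- arccos c)))\<^sup>2 = 1 - 2 * r * cos (arccos c) + r\<^sup>2"
    using dist_ray_unit_circle[of 1 r "arccos c"] by (simp add: scaleR_conv_of_real)
  also have "\<dots> = l1\<^sup>2" unfolding cos using assms by (simp add: c_def field_simps)
  finally show "dist 1 (of_real r * cis (- arccos c)) = l1" using assms by (simp add: power2_eq_iff_nonneg)
qed

lemma l_P_bounds: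
  assumes "petal_parameters n l1 l2"
  shows "0 < theta_bar n" "theta_bar n < beta l1" "(sin (theta_bar n))\<^sup>2 < l1\<^sup>2"
    "l2 < l_P l1 (theta_bar n)" "l_P l1 (theta_bar n) \<le> sqrt (1 - l1\<^sup>2)"
    "cos (theta_bar n) = (1 - l1\<^sup>2 + (l_P l1 (theta_bar n))\<^sup>2) / (2 * l_P l1 (theta_bar n))"
proof -
  note par = petal_parameters_bounds[OF assms]
  define \<theta> where "\<theta> = theta_bar n"
  show \<theta>: "0 < theta_bar n" "theta_bar n < beta l1" and lP: "l2 < l_P l1 (theta_bar n)"
    using assms by (auto simp: petal_parameters_def theta_bar_def)
  have "sin (theta_bar n) < sin (beta l1)" using \<theta> par by (intro sin_monotone_2pi) auto
  moreover have "0 < sin (theta_bar n)" using \<theta> par by (intro sin_gt_zero) linarith+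
  ultimately show s: "(sin (theta_bar n))\<^sup>2 < l1\<^sup>2" by (simp add: par(3) power_strict_mono)
  note circle = l_P_circle[of "theta_bar n" l1, OF less_imp_le[OF s]]
  show "cos (theta_bar n) = (1 - l1\<^sup>2 + (l_P l1 (theta_bar n))\<^sup>2) / (2 * l_P l1 (theta_bar n))"
    unfolding circle using lP par by simp
  \<comment> \<open>The nearer root is at most half the root sum, and the product of the roots is
    the squared tangent length 1 - l1^2.\<close>
  have "l_P l1 (theta_bar n) \<le> cos (theta_bar n)" unfolding l_P_def using s by simp
  then have "(l_P l1 (theta_bar n))\<^sup>2 \<le> l_P l1 (theta_bar n) * cos (theta_bar n)"
    using lP par by (simp add: power2_eq_square)
  then have "(l_P l1 (theta_bar n))\<^sup>2 \<le> 1 - l1\<^sup>2" using circle by linarith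
  then show "l_P l1 (theta_bar n) \<le> sqrt (1 - l1\<^sup>2)" by (rule real_le_rsqrt)
qed

lemma restricted_petal_fan:
  assumes n: "real n * \<theta> = 2 * pi" "i < n" and \<theta>: "0 < \<theta>" "\<theta> < beta l1" "\<theta> < pi / 2"
    and l1: "0 < l1" "l1 < 1" "(sin \<theta>)\<^sup>2 < l1\<^sup>2"
    and w: "dist 1 w = l1" "Im w < 0" "0 \<le> Re w" "0 \<le> Re (w * cis \<theta>)" "norm w < l_P l1 \<theta>"
    and v: "Im v < 0" "0 < Im (v * cis \<theta>)" "Re v < Re w" "Re (v * cis \<theta>) < Re (w * cis \<theta>)"
  shows "restricted_petal n l1 (fan \<theta> w v) i"
proof -
  define a where "a = cis (real i * \<theta>)"
  have a: "norm a = 1" "a \<noteq> 0" by (simp_all add: a_def)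
  have "a = cis (real ((i + n - 1) mod n) * \<theta>) * cis \<theta>"
    unfolding a_def using n by (intro fan_turn) auto
  then have A': "cis (real ((i + n - 1) mod n) * \<theta>) = a * cis (- \<theta>)"
    by (simp add: mult.assoc cis_mult)
  have lP: "0 < l_P l1 \<theta>" using w(5) norm_ge_zero[of w] by linarith
  define P Q R S where "P = of_real (l_P l1 \<theta>) * cis (- \<theta>)" and "Q = (of_real (1 - l1) :: complex)"
    and "R = a * cis (- \<theta>) * of_real (Re (w * cis \<theta>))" and "S = a * of_real (Re w)"
  have circle: "1 - l1\<^sup>2 + (l_P l1 \<theta>)\<^sup>2 = 2 * l_P l1 \<theta> * cos \<theta>"
    using l1 by (intro l_P_circle) simp
  have P1: "nearer_intersection 0 (a * cis (- \<theta>)) a l1 (a * P)"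
    using nearer_intersection_l_P[OF a(1) l1(1,3) lP]
    by (simp add: P_def scaleR_conv_of_real mult_ac)
  have Q1: "a * Q \<in> sphere a l1 \<inter> closed_segment 0 a"
  proof -
    have "a - a * Q = a * of_real l1" by (simp add: Q_def algebra_simps)
    then have "dist a (a * Q) = l1" using a l1 by (simp add: dist_norm norm_mult)
    moreover have "Q \<in> closed_segment 0 1"
      using l1 closed_segment_of_real[of 0 1, where 'a = complex]
      by (auto simp: Q_def closed_segment_eq_real_ivl simp del: of_real_diff)
    then have "a * Q \<in> closed_segment 0 a" using closed_segment_mult_complexI[of Q 0 1 a] by simp
    ultimately show ?thesis by simp
  qed
  have arc: "a * w \<in> open_small_arc a l1 (a * P) (a * Q)"
    unfolding Q_def
  proof (rule open_small_arc_mult)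
    have "(dist 1 P)\<^sup>2 = l1\<^sup>2"
      using dist_ray_unit_circle[of 1 "l_P l1 \<theta>" \<theta>] circle by (simp add: P_def scaleR_conv_of_real)
    then show "dist 1 P = l1" using l1 by (simp add: power2_eq_iff_nonneg)
    have "0 < sin \<theta>" using \<theta> by (intro sin_gt_zero) auto
    then show "Im P < 0" using lP by (simp add: P_def)
    \<comment> \<open>On the circle about A, 2 Re is 1 - l1^2 plus the squared distance from O, so
      |OB| < |OP| places B between Q and P.\<close>
    have "(dist 1 w)\<^sup>2 = 1 - 2 * Re w + (norm w)\<^sup>2"
      unfolding dist_norm cmod_power2 by (simp add: power2_eq_square algebra_simps)
    moreover have "(norm w)\<^sup>2 < (l_P l1 \<theta>)\<^sup>2" using w by (intro power_strict_mono) auto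
    ultimately show "Re w < Re P" using circle w(1) by (simp add: P_def)
  qed (use a l1 w in auto)
  have le1: "norm w < 1"
    using w(5) cos_le_one[of \<theta>] real_sqrt_ge_zero[of "l1\<^sup>2 - (sin \<theta>)\<^sup>2"] l1
    unfolding l_P_def by linarith
  have feet: "foot_on_segment (a * w) 0 (a * cis (- \<theta>)) R" "foot_on_segment (a * w) 0 a S"
  proof -
    have re: "Re (w * cis \<theta>) \<le> 1" "Re w \<le> 1"
      using le1 complex_Re_le_cmod[of w] complex_Re_le_cmod[of "w * cis \<theta>"]
      by (simp_all add: norm_mult del: times_complex.sel)
    have "a * cis (- \<theta>) * (w * cis \<theta>) = a * w * (cis (- \<theta>) * cis \<theta>)"
      by (simp only: mult_ac)
    then have aw: "a * cis (- \<theta>) * (w * cis \<theta>) = a * w" by (simp add: cis_mult)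
    have "foot_on_segment (a * cis (- \<theta>) * (w * cis \<theta>)) 0 (a * cis (- \<theta>)) R"
      unfolding R_def using a w re by (intro foot_on_segment_mult) (simp_all add: norm_mult del: times_complex.sel)
    then show "foot_on_segment (a * w) 0 (a * cis (- \<theta>)) R" unfolding aw .
    show "foot_on_segment (a * w) 0 a S"
      unfolding S_def using a w re by (intro foot_on_segment_mult) auto
  qed
  have inside: "a * v \<in> inside (closed_segment 0 R \<union> closed_segment R (a * w)
      \<union> closed_segment (a * w) S \<union> closed_segment S 0)"
    unfolding R_def S_def using a \<theta> v by (intro mem_inside_quadrilateral) auto
  have "petal_angle n (fan \<theta> w v) i < beta l1"
    using petal_angle_fan[of i n \<theta> w v] n \<theta> by simp
  then show ?thesis
    unfolding restricted_petal_def Let_def fan.simps A' a_def[symmetric]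
    using P1 Q1 arc feet inside by blast
qed

lemma ex_restricted_configuration:
  assumes "petal_parameters n l1 l2"
  obtains p where "petal_configuration n l1 l2 p" "\<And>i. i < n \<Longrightarrow> restricted_petal n l1 p i"
    "\<And>i. i < n \<Longrightarrow> 0 < petal_slack_at n l1 l2 p i"
proof -
  note par = petal_parameters_bounds[OF assms] and lP = l_P_bounds[OF assms]
  define \<theta> where "\<theta> = theta_bar n"
  note lP = lP[folded \<theta>_def]
  have n: "real n * \<theta> = 2 * pi" using par by (simp add: \<theta>_def theta_bar_def)
  \<comment> \<open>Constraint (c) leaves room for r = |OB|. By \<open>chord_angle_less\<close>, l2
    < r < \<open>l_P\<close> becomes theta_m < \<open>\<phi>\<close> <
    \<open>\<theta>\<close>.\<close>
  obtain r where r: "l2 < r" "r < l_P l1 \<theta>" using dense[OF lP(4)] by blast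
  have k: "0 < 1 - l1\<^sup>2" using par by (simp add: power_less_one_iff)
  then have "sqrt (1 - l1\<^sup>2) < 1" using par by simp
  then have r1: "0 < r" "r < 1" "r < sqrt (1 - l1\<^sup>2)" "1 - r < l1" using r lP(5) par by linarith+
  have "0 < (1 - l1\<^sup>2 + r\<^sup>2) / (2 * r)" using k r1 by (intro divide_pos_pos) (auto intro: add_pos_nonneg)
  then obtain \<phi> where \<phi>: "0 < \<phi>" "\<phi> < pi / 2" "cos \<phi> = (1 - l1\<^sup>2 + r\<^sup>2) / (2 * r)"
    "dist 1 (of_real r * cis (- \<phi>)) = l1"
    using chord_triangle[of r l1] r1 by blast
  have \<theta>: "0 < \<theta>" "\<theta> < beta l1" "\<theta> < pi / 2" using lP par by linarith+
  have "cos \<theta> < cos \<phi>"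
    unfolding lP(6) \<phi>(3) using chord_angle_less[OF r1(1) r(2) lP(5)] k by simp
  then have \<phi>\<theta>: "\<phi> < \<theta>" using cos_mono_less_eq[of \<theta> \<phi>] \<phi>(1,2) \<theta>(1,3) by simp
  have "cos \<phi> < cos (theta_m l1 l2)"
    unfolding par(7) \<phi>(3) using chord_angle_less[OF par(11) r(1)] r1 k by simp
  then have m\<phi>: "theta_m l1 l2 < \<phi>" using cos_mono_less_eq[of \<phi> "theta_m l1 l2"] \<phi>(1,2) par(5,6) by simp
  define w v where "w = of_real r * cis (- \<phi>)" and "v = of_real (r - l2) * cis (- \<phi>)"
  have wv\<theta>: "w * cis \<theta> = of_real r * cis (\<theta> - \<phi>)" "v * cis \<theta> = of_real (r - l2) * cis (\<theta> - \<phi>)"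
    by (simp_all add: w_def v_def mult.assoc cis_mult)
  have trig: "0 < sin \<phi>" "0 < sin (\<theta> - \<phi>)" "0 < cos \<phi>" "0 < cos (\<theta> - \<phi>)"
    using \<phi>(1,2) \<theta>(1,3) \<phi>\<theta> by (auto intro!: sin_gt_zero cos_gt_zero)
  have nw: "norm w = r" using r1 by (simp add: w_def norm_mult)
  have wv: "Im w < 0" "0 < Re w" "0 < Im (w * cis \<theta>)" "0 < Re (w * cis \<theta>)" "Im v < 0"
    "0 < Im (v * cis \<theta>)" "Re v < Re w" "Re (v * cis \<theta>) < Re (w * cis \<theta>)"
    unfolding wv\<theta> using trig r r1 par by (simp_all add: w_def v_def)
  have cfg: "petal_configuration n l1 l2 (fan \<theta> w v)"
    using petal_configuration_folded_fan[of n \<theta> \<phi> l2 r] n \<phi> \<phi>\<theta> par r by (simp add: w_def v_def)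
  moreover have "restricted_petal n l1 (fan \<theta> w v) i" if "i < n" for i
    using that n \<theta> par lP(3) wv nw r \<phi>(4) by (intro restricted_petal_fan) (auto simp: w_def)
  moreover have "0 < petal_slack_at n l1 l2 (fan \<theta> w v) i" if "i < n" for i
  proof -
    have "petal_angle n (fan \<theta> w v) i = \<theta>" using that n \<theta> by (intro petal_angle_fan) auto
    then show ?thesis
      unfolding petal_slack_at_def petal_slack_iff using wv m\<phi> \<phi>\<theta> r1 r nw
      by (simp del: times_complex.sel)
  qed
  ultimately show thesis by (rule that)
qed

text \<open>Straight petals packed into a fan of step pi/n. Petal 1 is used because petal 0 receives
  the remaining gap. The step is below alpha since 2 pi - beta > pi.\<close>

lemma ex_small_angle_configuration:
  assumes "petal_parameters n l1 l2"
  obtains q where "petal_configuration n l1 l2 q" "petal_angle n q 1 < alpha n l1"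
proof -
  note par = petal_parameters_bounds[OF assms]
  define \<delta> where "\<delta> = pi / real n"
  have \<delta>: "0 < \<delta>" "real n * \<delta> \<le> 2 * pi" "\<delta> < 2 * pi"
    using par by (simp_all add: \<delta>_def field_simps)
  have "petal_configuration n l1 l2 (fan \<delta> (of_real (1 + l1)) (of_real (1 + l1 + l2)))"
    using petal_configuration_straight_fan[OF \<delta>(1,2), of "1 + l1" "1 + l1 + l2"] par by simp
  moreover have "petal_angle n (fan \<delta> (of_real (1 + l1)) (of_real (1 + l1 + l2))) 1 = \<delta>"
    using par \<delta> by (intro petal_angle_fan) auto
  moreover have "\<delta> < alpha n l1"
  proof -
    have "\<delta> < pi / (real n - 1)" using par by (simp add: \<delta>_def divide_strict_left_mono)
    also have "\<dots> \<le> alpha n l1" unfolding alpha_def using par by (intro divide_right_mono) auto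
    finally show ?thesis .
  qed
  ultimately show thesis using that by simp
qed

text \<open>For n = 6 the angle theta_bar is pi/3. Taking l1 slightly above sin(pi/3) = 0.866...
  puts beta just above theta_bar and alpha just below it. Constraints (d) and (c) then confine l2 to
  about 0.431 < l2 < 0.4415. At l2 = \<open>l_P\<close> theta_m would equal theta_bar, so l2 is
  taken near the upper end to keep theta_m above alpha.\<close>

lemma petal_parameters_6: "petal_parameters 6 (217 / 250) (11 / 25)"
proof -
  define l1 :: real where "l1 = 217 / 250"
  have tb: "theta_bar 6 = pi / 3" by (simp add: theta_bar_def)
  have sc: "sin (beta l1) = l1" "cos (beta l1) = sqrt (1 - l1\<^sup>2)"
    by (simp_all add: beta_def l1_def cos_arcsin)
  have s3: "sqrt 3 < 17321 / 10000" "17320 / 10000 < sqrt 3"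
    by (rule real_less_lsqrt real_less_rsqrt; simp add: power2_eq_square)+
  \<comment> \<open>A margin for beta over pi/3: sqrt 3 / 2 + e / 2 is still below 0.868. It pushes
    alpha below pi/3 - e/5, whose cosine must exceed cos theta_m = 0.5002.\<close>
  define e :: real where "e = 3 / 1000"
  have "pi / 3 + e < beta l1"
  proof -
    have "sin (pi / 3 + e) = sqrt 3 / 2 * cos e + sin e / 2"
      by (simp add: sin_add sin_60 cos_60)
    also have "\<dots> \<le> sqrt 3 / 2 * 1 + e / 2"
      by (intro add_mono mult_left_mono divide_right_mono sin_x_le_x) (auto simp: e_def)
    also have "\<dots> < l1" using s3 by (simp add: e_def l1_def)
    finally have "arcsin (sin (pi / 3 + e)) < arcsin l1"
      by (subst arcsin_less_mono) (auto simp: l1_def)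
    moreover have "arcsin (sin (pi / 3 + e)) = pi / 3 + e"
      using pi_gt3 by (intro arcsin_sin) (auto simp: e_def)
    ultimately show ?thesis by (simp add: beta_def)
  qed
  then have \<beta>: "theta_bar 6 < beta l1" and \<alpha>: "alpha 6 l1 < pi / 3 - e / 5"
    by (simp_all add: tb alpha_def e_def)
  have "alpha 6 l1 < theta_m l1 (11 / 25)"
  proof -
    \<comment> \<open>Half of the linear term of the sine suffices: 0.866 * e/10 is about 0.00026,
      above the required 0.0002 even after the quadratic loss in the cosine.\<close>
    have "\<bar>sin (e / 5) - e / 5\<bar> \<le> (e / 5)\<^sup>2 / 2"
      using Maclaurin_sin_bound[of "e / 5" 2] by (simp add: numeral_2_eq_2 sin_coeff_def)
    then have "e / 10 \<le> sin (e / 5)" by (simp add: e_def power2_eq_square abs_if split: if_splits)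
    moreover have "1 - (e / 5)\<^sup>2 / 2 \<le> cos (e / 5)"
    proof -
      have "(sin (e / 10))\<^sup>2 \<le> (e / 10)\<^sup>2"
        using abs_sin_x_le_abs_x[of "e / 10"] by (simp only: abs_le_square_iff)
      then show ?thesis using cos_double_sin[of "e / 10"] by (simp add: power2_eq_square)
    qed
    moreover have "cos (pi / 3 - e / 5) = cos (e / 5) / 2 + sqrt 3 / 2 * sin (e / 5)"
      by (simp add: cos_diff sin_60 cos_60)
    moreover have "17320 / 10000 / 2 * (e / 10) \<le> sqrt 3 / 2 * sin (e / 5)"
      using s3 calculation by (intro mult_mono) (auto simp: e_def)
    ultimately have "(1 - l1\<^sup>2 + (11 / 25)\<^sup>2) / (2 * (11 / 25)) < cos (pi / 3 - e / 5)"
      by (simp add: e_def l1_def power2_eq_square)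
    then have "arccos (cos (pi / 3 - e / 5)) < theta_m l1 (11 / 25)"
      unfolding theta_m_def by (subst arccos_less_mono) (auto simp: l1_def power2_eq_square)
    moreover have "arccos (cos (pi / 3 - e / 5)) = pi / 3 - e / 5"
      using pi_gt3 by (intro arccos_cos) (auto simp: e_def)
    ultimately show ?thesis using \<alpha> by linarith
  qed
  moreover have "11 / 25 < l_P l1 (theta_bar 6)"
  proof -
    have "sqrt (l1\<^sup>2 - (sin (pi / 3))\<^sup>2) < 6 / 100"
      by (intro real_less_lsqrt) (auto simp: sin_60 l1_def power2_eq_square)
    then show ?thesis by (simp add: l_P_def tb cos_60)
  qed
  moreover have "sin (beta l1) * cos (beta l1) < 11 / 25"
  proof -
    have "sqrt (1 - l1\<^sup>2) < 1 / 2"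
      by (intro real_less_lsqrt) (auto simp: l1_def power2_eq_square)
    then show ?thesis unfolding sc by (simp add: l1_def)
  qed
  ultimately show ?thesis using \<beta> unfolding petal_parameters_def l1_def by simp
qed

theorem mainTheorem1:
  shows "\<exists>(n::nat) (l1::real) (l2::real).
    petal_parameters n l1 l2
    \<and> tree_linkage (petal_tree n l1 l2)
    \<and> (\<exists>p q.
         petal_configuration n l1 l2 p
         \<and> (\<forall>i<n. restricted_petal n l1 p i)
         \<and> petal_configuration n l1 l2 q
         \<and> (\<exists>i<n. petal_angle n q i < alpha n l1)
         \<and> \<not> equivalent_configurations (petal_tree n l1 l2) p q)"
proof -
  note par = petal_parameters_6
  obtain p where p: "petal_configuration 6 (217 / 250) (11 / 25) p"
      "\<And>i. i < 6 \<Longrightarrow> restricted_petal 6 (217 / 250) p i"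
    and slack: "\<And>i. i < 6 \<Longrightarrow> 0 < petal_slack_at 6 (217 / 250) (11 / 25) p i"
    using ex_restricted_configuration[OF par] by blast
  obtain q where q: "petal_configuration 6 (217 / 250) (11 / 25) q"
      "petal_angle 6 q 1 < alpha 6 (217 / 250)"
    using ex_small_angle_configuration[OF par] by blast
  have "\<not> equivalent_configurations (petal_tree 6 (217 / 250) (11 / 25)) p q"
    using q(2) by (intro not_equivalent_petal_configurations[OF par p(1) slack, of 1]) auto
  moreover have "tree_linkage (petal_tree 6 (217 / 250) (11 / 25))"
    by (intro tree_linkage_petal_tree) auto
  moreover have "(1::nat) < 6" by simp
  ultimately show ?thesis using par p q by blast
qed

end
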